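(* Let $W$ be a standard Brownian motion on $[0,T]$. There is an event of probability one on which $$\Omega_2(W;\delta)=O\left(\sqrt{T\delta\log\frac{eT}{\delta}}\right)\qquad\text{as }\delta\downarrow0.$$ Brownian paths are therefore almost surely $2$-rough, i.e. $\mathbb P(W\in\mathscr R_2([0,T]))=1$, and $$\mathfrak R_{2,L}(W)=O\left(T\sqrt{\frac{\log(eL)}{L}}\right)\qquad\text{a.s. as }L\to\infty .$$ (The implied constants may depend on the sample path.)
   Context: Stopped quadratic energy: for a finite partition $\lambda=\{0=u_0<\dots<u_N=T\}$ and $t\in[0,T]$, $\mathsf V^2_\lambda(x;t):=\sum_{i=0}^{N-1}|x(u_{i+1}\wedge t)-x(u_i\wedge t)|^2$. Shifted uniform grids: for $0<\ell\le T$, $0\le a<\ell$, $\Pi(\ell,a):=\{0,T\}\cup\{a+k\ell: k\in\mathbb Z,\ 0<a+k\ell<T\}$. $\Omega_2(W;\delta):=\sup_{0<\ell\le\delta}\sup_{0\le a<\ell}\sup_{t\in[0,T]}|\mathsf V^2_{\Pi(\ell,a)}(W;t)-t|$. $\mathscr R_2([0,T])$ is the class of $2$-rough paths: $x\in C([0,T];\mathbb R)$ for which there is a continuous nondecreasing $A:[0,T]\to[0,\infty)$ with $A(T)>A(0)=0$ such that $\sup_{0<\ell\le\delta}\sup_{0\le a<\ell}\sup_{t\in[0,T]}|\mathsf V^2_{\Pi(\ell,a)}(x;t)-A(t)|\to0$ as $\delta\downarrow0$. Dyadic roughness modulus: $h_m:=T2^{-m}$, $\mathbb T_m:=\{jh_m:0\le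 j\le 2^m\}$; for integers $1\le b\le 2^m$, $0\le r<b$, $\mathbb T_m^{b,r}:=\{0,T\}\cup\{jh_m:1\le j<2^m,\ j\equiv r\pmod b\}$; for integers $L\ge2$, $$\mathfrak R_{2,L}(x):=\limsup_{m\to\infty}\ \sup_{L\le b\le\lfloor 2^m/L\rfloor,\ 0\le r<b}\ \sup_{t\in[0,T]}\bigl|\mathsf V^2_{\mathbb T_m^{b,r}}(x;t)-\mathsf V^2_{\mathbb T_m}(x;t)\bigr|.$$ *)

theory Defs
  imports "HOL-Probability.Probability"
begin

text \<open>
  Paths on \<open>[0,T]\<close> are functions \<open>real \<Rightarrow> real\<close> of which only the values on \<open>{0..T}\<close> matter.
  A partition is represented by the finite set of its points. Suprema are taken in \<open>ennreal\<close>,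
  because for a general continuous path they may be infinite; the supremum over an empty index
  set is \<open>0\<close>.
\<close>

definition stopped_energy :: "real set \<Rightarrow> (real \<Rightarrow> real) \<Rightarrow> real \<Rightarrow> real" where
  "stopped_energy P x t =
     (let u = sorted_list_of_set P
      in \<Sum>i<card P - 1. \<bar>x (min (u ! Suc i) t) - x (min (u ! i) t)\<bar>\<^sup>2)"

definition shifted_grid :: "real \<Rightarrow> real \<Rightarrow> real \<Rightarrow> real set" where
  "shifted_grid T l a =
     {0, T} \<union> {a + of_int k * l | k :: int. 0 < a + of_int k * l \<and> a + of_int k * l < T}"

definition grid_deviation ::
    "real \<Rightarrow> (real \<Rightarrow> real) \<Rightarrow> (real \<Rightarrow> real) \<Rightarrow> real \<Rightarrow> ennreal" where
  "grid_deviation T x A \<delta> =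
     (SUP l\<in>{l. 0 < l \<and> l \<le> \<delta> \<and> l \<le> T}. SUP a\<in>{0..<l}. SUP t\<in>{0..T}.
        ennreal \<bar>stopped_energy (shifted_grid T l a) x t - A t\<bar>)"

definition Omega2 :: "real \<Rightarrow> (real \<Rightarrow> real) \<Rightarrow> real \<Rightarrow> ennreal" where
  "Omega2 T x \<delta> = grid_deviation T x (\<lambda>t. t) \<delta>"

definition rough_paths2 :: "real \<Rightarrow> (real \<Rightarrow> real) set" where
  "rough_paths2 T =
     {x. continuous_on {0..T} x \<and>
         (\<exists>A. continuous_on {0..T} A \<and> mono_on {0..T} A \<and> A 0 = 0 \<and> 0 < A T \<and>
              (grid_deviation T x A \<longlongrightarrow> 0) (at_right 0))}"

definition dyadic_grid :: "real \<Rightarrow> nat \<Rightarrow> real set" where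
  "dyadic_grid T m = {real j * (T / 2 ^ m) | j. j \<le> 2 ^ m}"

definition dyadic_subgrid :: "real \<Rightarrow> nat \<Rightarrow> nat \<Rightarrow> nat \<Rightarrow> real set" where
  "dyadic_subgrid T m b r =
     {0, T} \<union> {real j * (T / 2 ^ m) | j. 1 \<le> j \<and> j < 2 ^ m \<and> j mod b = r mod b}"

text \<open>Below, \<open>2 ^ m div L\<close> is the integer part of the quotient; the index set of \<open>b\<close> is nonempty
  as soon as \<open>2 ^ m \<ge> L\<^sup>2\<close>, so the convention for empty suprema does not affect the limes superior.\<close>

definition dyadic_roughness2 :: "real \<Rightarrow> nat \<Rightarrow> (real \<Rightarrow> real) \<Rightarrow> ennreal" where
  "dyadic_roughness2 T L x =
     limsup (\<lambda>m. SUP b\<in>{L..2 ^ m div L}. SUP r\<in>{..<b}. SUP t\<in>{0..T}.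
        ennreal \<bar>stopped_energy (dyadic_subgrid T m b r) x t
                 - stopped_energy (dyadic_grid T m) x t\<bar>)"

text \<open>Note that the second parameter of \<^const>\<open>normal_density\<close> is the standard deviation.\<close>

locale standard_brownian_motion = prob_space M for M :: "'a measure" +
  fixes T :: real and W :: "real \<Rightarrow> 'a \<Rightarrow> real"
  assumes random_variable: "\<And>t. t \<in> {0..T} \<Longrightarrow> W t \<in> borel_measurable M"
    and start: "AE \<omega> in M. W 0 \<omega> = 0"
    and indep_increments:
      "\<And>(n::nat) u. \<lbrakk>\<And>i. i \<le> n \<Longrightarrow> u i \<in> {0..T}; \<And>i. i < n \<Longrightarrow> u i < u (Suc i)\<rbrakk> \<Longrightarrow>
         indep_vars (\<lambda>_. borel) (\<lambda>i \<omega>. W (u (Suc i)) \<omega> - W (u i) \<omega>) {..<n}"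
    and normal_increments:
      "\<And>s t. \<lbrakk>0 \<le> s; s < t; t \<le> T\<rbrakk> \<Longrightarrow>
         distributed M lborel (\<lambda>\<omega>. W t \<omega> - W s \<omega>) (normal_density 0 (sqrt (t - s)))"
    and continuous_paths: "AE \<omega> in M. continuous_on {0..T} (\<lambda>t. W t \<omega>)"

end

theory Submission
  imports Defs "HOL-Real_Asymp.Real_Asymp"
begin

text \<open>
  For one grid of mesh \<open>l\<close> the deviation \<open>V(t) - t\<close> is a sum of independent centred squares of
  Gaussian variables, so by the Chernoff bound it exceeds \<open>K sqrt (T l log (e T / l))\<close> with
  probability at most a power of \<open>l / T\<close> whose exponent grows linearly in \<open>K\<close>. For meshes
  between \<open>T / 2 ^ (n + 1)\<close> and \<open>T / 2 ^ n\<close> this is summed over a net of parameters \<open>(l, a, t)\<close>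
  of size polynomial in \<open>2 ^ n\<close>, and Borel--Cantelli applies. Clamping the grid points to \<open>[0, t]\<close>
  writes \<open>V\<close> as a sum with a fixed number of terms that depends continuously on \<open>(l, a, t)\<close>, so
  a Hoelder modulus of the path carries the estimate from the net to all parameters. The dyadic
  subgrids with step \<open>b\<close> are shifted grids of mesh \<open>b T / 2 ^ m\<close>, at most \<open>T / L\<close>.
\<close>

section \<open>Partition sums along enumerations with repeated points\<close>

text \<open>Induction on the enumeration: a new point either repeats the last one and contributes
  \<open>g s s = 0\<close>, or exceeds all earlier ones and is appended to the sorted list. Keeping
  \<open>g\<close> general serves energies, centred sums and the count of long gaps alike.\<close>

lemma sum_sorted_list_of_range:
  fixes v :: "nat \<Rightarrow> real" and g :: "real \<Rightarrow> real \<Rightarrow> 'b::comm_monoid_add"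
  assumes g: "\<And>s. g s s = 0"
    and "\<And>i. i < N \<Longrightarrow> v i \<le> v (Suc i)"
  defines "u \<equiv> (!) (sorted_list_of_set (v ` {..N}))"
  shows "(\<Sum>i<card (v ` {..N}) - 1. g (u i) (u (Suc i))) = (\<Sum>i<N. g (v i) (v (Suc i)))"
  using assms(2) unfolding u_def
proof (induction N)
  case 0
  then show ?case by simp
next
  case (Suc N)
  let ?P = "v ` {..N}"
  let ?xs = "sorted_list_of_set ?P"
  have IH: "(\<Sum>i<card ?P - 1. g (?xs ! i) (?xs ! Suc i)) = (\<Sum>i<N. g (v i) (v (Suc i)))"
    using Suc.IH Suc.prems by simp
  have le: "v i \<le> v N" if "i \<le> N" for i
    using that
  proof (induction rule: inc_induct)
    case (step n)
    then show ?case using Suc.prems[of n] by simp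
  qed simp
  have last: "?xs ! (card ?P - 1) = v N"
  proof -
    have "?xs ! (length ?xs - 1) = Max (set ?xs)"
    proof (rule Max_eqI[symmetric])
      fix y assume "y \<in> set ?xs"
      then obtain j where "j < length ?xs" "y = ?xs ! j"
        by (metis in_set_conv_nth)
      then show "y \<le> ?xs ! (length ?xs - 1)"
        by (simp add: sorted_nth_mono)
    next
      show "?xs ! (length ?xs - 1) \<in> set ?xs"
        by (rule nth_mem) (simp add: card_gt_0_iff)
    qed simp
    also have "\<dots> = v N"
      using le by (auto intro!: Max_eqI)
    finally show ?thesis by simp
  qed
  have pos: "card ?P > 0" by (simp add: card_gt_0_iff)
  show ?case
  proof (cases "v (Suc N) = v N")
    case True
    then have "v ` {..Suc N} = ?P" by (auto simp: atMost_Suc)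
    then show ?thesis using IH True g by simp
  next
    case False
    then have lt: "v N < v (Suc N)" using Suc.prems[of N] by simp
    then have notin: "v (Suc N) \<notin> ?P" using le by force
    have img: "v ` {..Suc N} = insert (v (Suc N)) ?P" by (auto simp: atMost_Suc)
    have xs: "sorted_list_of_set (v ` {..Suc N}) = ?xs @ [v (Suc N)]"
      unfolding img using notin lt le
      by (subst sorted_list_of_set_insert) (force intro!: sorted_insort_is_snoc)+
    have "card (v ` {..Suc N}) - 1 = Suc (card ?P - 1)"
      unfolding img using notin pos by simp
    moreover obtain c where "card ?P = Suc c" using pos gr0_implies_Suc by blast
    ultimately show ?thesis
      using IH last unfolding xs by (simp add: nth_append)
  qed
qed

lemma stopped_energy_monotone_enumeration:
  fixes v :: "nat \<Rightarrow> real"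
  assumes "\<And>i. i < N \<Longrightarrow> v i \<le> v (Suc i)"
  shows "stopped_energy (v ` {..N}) x t = (\<Sum>i<N. (x (min (v (Suc i)) t) - x (min (v i) t))\<^sup>2)"
  using sum_sorted_list_of_range[of "\<lambda>r s. (x (min s t) - x (min r t))\<^sup>2" N v] assms
  by (simp add: stopped_energy_def Let_def)

section \<open>Exponential moments and Chernoff bounds for quadratic variations\<close>

text \<open>With u = l \<sigma>^2, the exponential tilt turns the Gaussian density of variance
  \<sigma>^2 into a multiple of the one of variance \<sigma>^2 / (1 - 2 u). The multiple
  \<open>exp (- u) / sqrt (1 - 2 * u)\<close> is therefore the exact value of the integral.\<close>

lemma nn_integral_exp_centered_square:
  assumes D: "distributed M lborel X (normal_density 0 \<sigma>)" and \<sigma>: "0 < \<sigma>"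
    and l: "\<bar>l\<bar> * \<sigma>\<^sup>2 \<le> 1/4"
  shows "(\<integral>\<^sup>+\<omega>. ennreal (exp (l * ((X \<omega>)\<^sup>2 - \<sigma>\<^sup>2))) \<partial>M) \<le> ennreal (exp (4 * l\<^sup>2 * \<sigma> ^ 4))"
proof -
  define u where "u = l * \<sigma>\<^sup>2"
  define \<tau> where "\<tau> = \<sigma> / sqrt (1 - 2 * u)"
  have u: "\<bar>u\<bar> \<le> 1/4" using l by (simp add: u_def abs_mult)
  then have u1: "1 - 2 * u > 0" by linarith
  have \<tau>: "\<tau> > 0" using \<sigma> u1 by (simp add: \<tau>_def)
  have \<tau>2: "\<tau>\<^sup>2 = \<sigma>\<^sup>2 / (1 - 2 * u)" using u1 by (simp add: \<tau>_def power_divide)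
  have dens: "normal_density 0 \<sigma> y * exp (l * (y\<^sup>2 - \<sigma>\<^sup>2))
      = exp (- u) / sqrt (1 - 2 * u) * normal_density 0 \<tau> y" for y
  proof -
    have e: "- y\<^sup>2 / (2 * \<sigma>\<^sup>2) + l * (y\<^sup>2 - \<sigma>\<^sup>2) = - u + (- y\<^sup>2 / (2 * \<tau>\<^sup>2))"
      using u1 \<sigma> by (simp add: \<tau>2 u_def divide_simps) (simp add: algebra_simps)
    have s: "sqrt (2 * pi * \<tau>\<^sup>2) = sqrt (2 * pi * \<sigma>\<^sup>2) / sqrt (1 - 2 * u)"
      by (simp add: \<tau>2 real_sqrt_divide)
    have "normal_density 0 \<sigma> y * exp (l * (y\<^sup>2 - \<sigma>\<^sup>2))
        = 1 / sqrt (2 * pi * \<sigma>\<^sup>2) * exp (- y\<^sup>2 / (2 * \<sigma>\<^sup>2) + l * (y\<^sup>2 - \<sigma>\<^sup>2))"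
      unfolding normal_density_def exp_add by simp
    also have "\<dots> = exp (- u) / sqrt (1 - 2 * u) * (1 / sqrt (2 * pi * \<tau>\<^sup>2) * exp (- y\<^sup>2 / (2 * \<tau>\<^sup>2)))"
      unfolding e exp_add s using u1 by simp
    finally show ?thesis by (simp add: normal_density_def)
  qed
  have "(\<integral>\<^sup>+\<omega>. ennreal (exp (l * ((X \<omega>)\<^sup>2 - \<sigma>\<^sup>2))) \<partial>M)
      = (\<integral>\<^sup>+y. ennreal (normal_density 0 \<sigma> y) * ennreal (exp (l * (y\<^sup>2 - \<sigma>\<^sup>2))) \<partial>lborel)"
    by (subst distributed_nn_integral[OF D, symmetric]) simp_all
  also have "\<dots> = (\<integral>\<^sup>+y. ennreal (exp (- u) / sqrt (1 - 2 * u)) * ennreal (normal_density 0 \<tau> y) \<partial>lborel)"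
    using u1 by (intro nn_integral_cong) (simp add: dens flip: ennreal_mult)
  also have "\<dots> = ennreal (exp (- u) / sqrt (1 - 2 * u)) * emeasure (density lborel (normal_density 0 \<tau>)) UNIV"
    by (simp add: nn_integral_cmult emeasure_density)
  also have "\<dots> = ennreal (exp (- u) / sqrt (1 - 2 * u))"
  proof -
    interpret P: prob_space "density lborel (normal_density 0 \<tau>)"
      using \<tau> by (rule prob_space_normal_density)
    show ?thesis using P.emeasure_space_1 by simp
  qed
  also have "\<dots> \<le> ennreal (exp (4 * l\<^sup>2 * \<sigma> ^ 4))"
  proof (rule ennreal_leI)
    \<comment> \<open>The estimate |ln (1 + y) - y| \<le> 2 y^2 requires |y| \<le> 1/2; for y = - 2
      u this is the assumption on \<open>l\<close>, and half of 8 u^2 is the final exponent.\<close>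
    have "\<bar>ln (1 + (- 2 * u)) - (- 2 * u)\<bar> \<le> 2 * (- 2 * u)\<^sup>2"
      using u by (intro abs_ln_one_plus_x_minus_x_bound) (simp add: abs_mult)
    then have ln: "- 2 * u - 8 * u\<^sup>2 \<le> ln (1 - 2 * u)" by (simp add: power2_eq_square)
    have "exp (- u) / sqrt (1 - 2 * u) = exp (- u - ln (1 - 2 * u) / 2)"
      using u1 by (simp add: exp_diff flip: ln_sqrt)
    also have "\<dots> \<le> exp (4 * u\<^sup>2)" using ln by simp
    also have "4 * u\<^sup>2 = 4 * l\<^sup>2 * \<sigma> ^ 4" by (simp add: u_def power_mult_distrib flip: power_mult)
    finally show "exp (- u) / sqrt (1 - 2 * u) \<le> exp (4 * l\<^sup>2 * \<sigma> ^ 4)" .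
  qed
  finally show ?thesis .
qed

context standard_brownian_motion
begin

text \<open>Independence factors the exponential moment over the increments. Each factor has the
  squared gap d^2 \<le> h d in its exponent, and the gaps add up to at most T.\<close>

lemma nn_integral_exp_quadratic_variation_strict:
  assumes u: "\<And>i. i \<le> K \<Longrightarrow> u i \<in> {0..T}" and less: "\<And>i. i < K \<Longrightarrow> u i < u (Suc i)"
    and h: "\<And>i. i < K \<Longrightarrow> u (Suc i) - u i \<le> h" and "0 \<le> h" and l: "\<bar>l\<bar> * h \<le> 1/4"
  shows "(\<integral>\<^sup>+\<omega>. ennreal (exp (l * (\<Sum>i<K. (W (u (Suc i)) \<omega> - W (u i) \<omega>)\<^sup>2 - (u (Suc i) - u i)))) \<partial>M)
    \<le> ennreal (exp (4 * l\<^sup>2 * h * T))"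
proof -
  let ?D = "\<lambda>i \<omega>. W (u (Suc i)) \<omega> - W (u i) \<omega>" and ?d = "\<lambda>i. u (Suc i) - u i"
  have ind: "indep_vars (\<lambda>_. borel) ?D {..<K}" using u less by (rule indep_increments)
  have "(\<integral>\<^sup>+\<omega>. ennreal (exp (l * (\<Sum>i<K. (?D i \<omega>)\<^sup>2 - ?d i))) \<partial>M)
      = (\<integral>\<^sup>+\<omega>. (\<Prod>i<K. ennreal (exp (l * ((?D i \<omega>)\<^sup>2 - ?d i)))) \<partial>M)"
    by (simp add: prod_ennreal sum_distrib_left flip: exp_sum)
  also have "\<dots> = (\<Prod>i<K. \<integral>\<^sup>+\<omega>. ennreal (exp (l * ((?D i \<omega>)\<^sup>2 - ?d i))) \<partial>M)"
    by (intro indep_vars_nn_integral indep_vars_compose2[OF ind]) auto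
  also have "\<dots> \<le> (\<Prod>i<K. ennreal (exp (4 * l\<^sup>2 * h * ?d i)))"
  proof (intro prod_mono_ennreal)
    fix i assume "i \<in> {..<K}"
    then have i: "i < K" by simp
    have d: "0 < ?d i" using less[OF i] by simp
    have "distributed M lborel (?D i) (normal_density 0 (sqrt (?d i)))"
      using u[of i] u[of "Suc i"] less[OF i] i by (intro normal_increments) auto
    moreover have "\<bar>l\<bar> * ?d i \<le> 1/4"
      using mult_left_mono[OF h[OF i], of "\<bar>l\<bar>"] l by linarith
    ultimately have "(\<integral>\<^sup>+\<omega>. ennreal (exp (l * ((?D i \<omega>)\<^sup>2 - ?d i))) \<partial>M)
        \<le> ennreal (exp (4 * l\<^sup>2 * sqrt (?d i) ^ 4))"
      using nn_integral_exp_centered_square[of M "?D i" "sqrt (?d i)" l] d by simp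
    also have "sqrt (?d i) ^ 4 = ?d i * ?d i"
      using d by (simp add: power4_eq_xxxx)
    also have "ennreal (exp (4 * l\<^sup>2 * (?d i * ?d i))) \<le> ennreal (exp (4 * l\<^sup>2 * h * ?d i))"
      using mult_right_mono[OF h[OF i], of "?d i"] d
      by (intro ennreal_leI) (simp add: mult.assoc mult_left_mono)
    finally show "(\<integral>\<^sup>+\<omega>. ennreal (exp (l * ((?D i \<omega>)\<^sup>2 - ?d i))) \<partial>M)
        \<le> ennreal (exp (4 * l\<^sup>2 * h * ?d i))" .
  qed
  also have "\<dots> = ennreal (exp (4 * l\<^sup>2 * h * (u K - u 0)))"
    by (simp add: prod_ennreal flip: exp_sum sum_distrib_left) (simp add: sum_lessThan_telescope)
  also have "\<dots> \<le> ennreal (exp (4 * l\<^sup>2 * h * T))"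
    using u[of 0] u[of K] \<open>0 \<le> h\<close> by (intro ennreal_leI) (simp add: mult_left_mono)
  finally show ?thesis .
qed

text \<open>Chernoff's bound for both signs of the centred sum. Independence of increments is given
  for strictly increasing times, so the points are first replaced by their sorted list
  \<open>u\<close> without repetitions, which leaves the sum unchanged.\<close>

lemma prob_quadratic_variation_deviation:
  assumes v: "\<And>i. i \<le> N \<Longrightarrow> v i \<in> {0..T}" and mono: "\<And>i. i < N \<Longrightarrow> v i \<le> v (Suc i)"
    and h: "\<And>i. i < N \<Longrightarrow> v (Suc i) - v i \<le> h" "0 \<le> h" and l: "0 < l" "l * h \<le> 1/4"
  shows "prob {\<omega>\<in>space M. \<epsilon> \<le> \<bar>(\<Sum>i<N. (W (v (Suc i)) \<omega> - W (v i) \<omega>)\<^sup>2) - (v N - v 0)\<bar>}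
    \<le> 2 * exp (4 * l\<^sup>2 * h * T - l * \<epsilon>)"
proof -
  define u where "u = (!) (sorted_list_of_set (v ` {..N}))"
  define K where "K = card (v ` {..N}) - 1"
  let ?Z = "\<lambda>\<omega>. (\<Sum>i<N. (W (v (Suc i)) \<omega> - W (v i) \<omega>)\<^sup>2) - (v N - v 0)"
  have [measurable]: "random_variable borel (W (v i))" if "i \<le> N" for i
    using v[OF that] by (rule random_variable)
  have Zm [measurable]: "?Z \<in> borel_measurable M" by measurable
  have len: "length (sorted_list_of_set (v ` {..N})) = Suc K"
    by (simp add: K_def card_gt_0_iff)
  have u: "u i \<in> {0..T}" if "i \<le> K" for i
  proof -
    have "u i \<in> set (sorted_list_of_set (v ` {..N}))"
      unfolding u_def using that len by (intro nth_mem) simp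
    then show ?thesis using v by auto
  qed
  have less: "u i < u (Suc i)" if "i < K" for i
    unfolding u_def using that len
    by (intro sorted_wrt_nth_less[OF strict_sorted_list_of_set]) auto
  have gap: "u (Suc i) - u i \<le> h" if "i < K" for i
  proof - \<comment> \<open>count the gaps longer than \<open>h\<close>\<close>
    have "(\<Sum>i<K. if h < u (Suc i) - u i then 1 else 0 :: nat) = 0"
      using sum_sorted_list_of_range[of "\<lambda>r s. if h < s - r then 1 else 0 :: nat" N v] h mono
      by (simp add: u_def K_def leD)
    then show ?thesis using that by (auto simp: not_less split: if_splits)
  qed
  have Z: "?Z \<omega> = (\<Sum>i<K. (W (u (Suc i)) \<omega> - W (u i) \<omega>)\<^sup>2 - (u (Suc i) - u i))" for \<omega>
    using sum_sorted_list_of_range[of "\<lambda>r s. (W s \<omega> - W r \<omega>)\<^sup>2 - (s - r)" N v] mono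
    by (simp add: u_def K_def sum_subtractf flip: sum_lessThan_telescope[of v])
  have tail: "prob {\<omega>\<in>space M. \<epsilon> \<le> c * ?Z \<omega>} \<le> exp (4 * l\<^sup>2 * h * T - l * \<epsilon>)" if c: "\<bar>c\<bar> = 1" for c :: real
  proof -
    have "emeasure M {\<omega>\<in>space M. \<epsilon> \<le> c * ?Z \<omega>}
        \<le> ennreal (exp (- l * \<epsilon>)) * (\<integral>\<^sup>+\<omega>. ennreal (exp (l * (c * ?Z \<omega>))) * indicator (space M) \<omega> \<partial>M)"
      using l(1) by (intro Chernoff_ineq_nn_integral_ge) simp_all
    also have "(\<integral>\<^sup>+\<omega>. ennreal (exp (l * (c * ?Z \<omega>))) * indicator (space M) \<omega> \<partial>M)
        = (\<integral>\<^sup>+\<omega>. ennreal (exp ((l * c) * ?Z \<omega>)) \<partial>M)"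
      by (intro nn_integral_cong) (simp add: mult.assoc)
    also have "\<dots> \<le> ennreal (exp (4 * (l * c)\<^sup>2 * h * T))"
      unfolding Z using u less gap h(2) l c
      by (intro nn_integral_exp_quadratic_variation_strict) (auto simp: abs_mult)
    also have "(l * c)\<^sup>2 = l\<^sup>2" using c by (simp add: power_mult_distrib abs_square_eq_1)
    finally have "emeasure M {\<omega>\<in>space M. \<epsilon> \<le> c * ?Z \<omega>}
        \<le> ennreal (exp (- l * \<epsilon>)) * ennreal (exp (4 * l\<^sup>2 * h * T))"
      by (simp add: mult_left_mono)
    then have "ennreal (prob {\<omega>\<in>space M. \<epsilon> \<le> c * ?Z \<omega>}) \<le> ennreal (exp (4 * l\<^sup>2 * h * T - l * \<epsilon>))"
      by (simp add: emeasure_eq_measure mult.commute exp_diff exp_minus divide_inverse flip: ennreal_mult)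
    then show ?thesis by simp
  qed
  have "prob {\<omega>\<in>space M. \<epsilon> \<le> \<bar>?Z \<omega>\<bar>}
      \<le> prob ({\<omega>\<in>space M. \<epsilon> \<le> 1 * ?Z \<omega>} \<union> {\<omega>\<in>space M. \<epsilon> \<le> - 1 * ?Z \<omega>})"
    by (intro finite_measure_mono) auto
  also have "\<dots> \<le> prob {\<omega>\<in>space M. \<epsilon> \<le> 1 * ?Z \<omega>} + prob {\<omega>\<in>space M. \<epsilon> \<le> - 1 * ?Z \<omega>}"
    by (intro measure_Un_le) auto
  also have "\<dots> \<le> 2 * exp (4 * l\<^sup>2 * h * T - l * \<epsilon>)"
    using tail[of 1] tail[of "- 1"] by simp
  finally show ?thesis .
qed

end

section \<open>The error scale at mesh \<open>T / 2 ^ n\<close>\<close>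

text \<open>Up to constants, \<open>sqrt (T l log (e T / l))\<close> for \<open>l\<close> near \<open>T / 2 ^ n\<close>.\<close>

definition level_error :: "real \<Rightarrow> nat \<Rightarrow> real" where
  "level_error T n = T * sqrt (real (Suc n) / 2 ^ n)"

lemma Suc_le_power_two: "real (Suc n) \<le> 2 ^ n"
  by (induction n) simp_all

lemma level_error_pos: "0 < T \<Longrightarrow> 0 < level_error T n"
  by (simp add: level_error_def)

text \<open>The ratio r = (n + 1) / 2^n is at most 1, hence r \<le> sqrt r. This keeps the Chernoff
  parameter at level n within its admissible range.\<close>

lemma level_error_ge:
  assumes "0 \<le> T"
  shows "T * (real (Suc n) / 2 ^ n) \<le> level_error T n"
proof -
  let ?r = "real (Suc n) / 2 ^ n"
  have "?r \<le> 1" using Suc_le_power_two[of n] by simp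
  then have "?r * ?r \<le> ?r * 1" by (intro mult_left_mono) auto
  then have "?r \<le> sqrt ?r" by (intro real_le_rsqrt) (simp only: power2_eq_square mult_1_right)
  then show ?thesis unfolding level_error_def using assms by (rule mult_left_mono)
qed

lemma level_error_ge':
  assumes "0 \<le> T"
  shows "T / 2 ^ n \<le> level_error T n"
proof -
  have "T / 2 ^ n \<le> T * (real (Suc n) / 2 ^ n)"
    using assms by (simp add: divide_right_mono mult_left_mono field_simps)
  then show ?thesis using level_error_ge[OF assms, of n] by linarith
qed

text \<open>Bernoulli's inequality bounds n + 1 by 2 (3/2)^n, and 3/2 divided by 2 is the ratio 3/4.
  Pure geometric decay is what the chaining of dyadic increments needs.\<close>

lemma level_error_geometric:
  assumes "0 \<le> T"
  shows "level_error T n \<le> 2 * T * sqrt (3/4) ^ n"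
proof -
  have "1 + real n * (1/2) \<le> (1 + 1/2 :: real) ^ n"
    by (rule Bernoulli_inequality) simp
  then have "real (Suc n) \<le> 2 * (3/2) ^ n" by simp
  then have "real (Suc n) / 2 ^ n \<le> 2 * (3/2) ^ n / 2 ^ n"
    by (intro divide_right_mono) auto
  also have "\<dots> = 2 * (3/4) ^ n" by (simp add: power_divide flip: power_mult_distrib)
  also have "\<dots> \<le> 4 * (3/4) ^ n" by simp
  finally have "sqrt (real (Suc n) / 2 ^ n) \<le> sqrt (4 * (3/4) ^ n)" by simp
  also have "\<dots> = 2 * sqrt (3/4) ^ n" by (simp only: real_sqrt_mult real_sqrt_power real_sqrt_four)
  finally have "sqrt (real (Suc n) / 2 ^ n) \<le> 2 * sqrt (3/4) ^ n" .
  from mult_left_mono[OF this assms] show ?thesis by (simp add: level_error_def mult_ac)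
qed

context standard_brownian_motion
begin

lemma prob_quadratic_variation_level:
  assumes T: "0 < T" and v: "\<And>i. i \<le> N \<Longrightarrow> v i \<in> {0..T}" and mono: "\<And>i. i < N \<Longrightarrow> v i \<le> v (Suc i)"
    and h: "\<And>i. i < N \<Longrightarrow> v (Suc i) - v i \<le> T / 2 ^ n"
  shows "prob {\<omega>\<in>space M. 264 * level_error T n \<le> \<bar>(\<Sum>i<N. (W (v (Suc i)) \<omega> - W (v i) \<omega>)\<^sup>2) - (v N - v 0)\<bar>}
    \<le> 2 * exp (- 65 * real (Suc n))"
proof -
  let ?e = "level_error T n"
  have e: "0 < ?e" using T by (rule level_error_pos)
  have e2: "?e\<^sup>2 = T\<^sup>2 * real (Suc n) / 2 ^ n"
    by (simp add: level_error_def power_mult_distrib)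
  \<comment> \<open>With this Chernoff parameter, \<open>l * ?e\<close> is (n + 1) / 4, so the
    variance term is (n + 1) / 4 while the threshold 264 contributes 66 (n + 1). The remaining rate
    65 beats a union over 2^(64 (n + 1)) events.\<close>
  define l where "l = real (Suc n) / (4 * ?e)"
  have l: "0 < l" using e by (simp add: l_def)
  have lh: "l * (T / 2 ^ n) \<le> 1 / 4"
  proof -
    have "l * (T / 2 ^ n) = T * (real (Suc n) / 2 ^ n) / (4 * ?e)" by (simp add: l_def mult_ac)
    also have "\<dots> \<le> ?e / (4 * ?e)"
      using level_error_ge[of T n] T e by (intro divide_right_mono) auto
    finally show ?thesis using e by simp
  qed
  have le: "l * (264 * ?e) = 66 * real (Suc n)" using e by (simp add: l_def)
  have var: "4 * l\<^sup>2 * (T / 2 ^ n) * T = real (Suc n) / 4"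
  proof -
    have le4: "l * ?e = real (Suc n) / 4" using e by (simp add: l_def)
    have "4 * (l * ?e)\<^sup>2 = real (Suc n) / 4 * real (Suc n)"
      by (simp only: le4 power2_eq_square)
    moreover have "4 * (l * ?e)\<^sup>2 = 4 * l\<^sup>2 * (T / 2 ^ n) * T * real (Suc n)"
      unfolding power_mult_distrib e2 by (simp only: power2_eq_square times_divide_eq_left times_divide_eq_right mult_ac)
    ultimately have "4 * l\<^sup>2 * (T / 2 ^ n) * T * real (Suc n) = real (Suc n) / 4 * real (Suc n)" by simp
    then show ?thesis by (subst (asm) mult_right_cancel) simp_all
  qed
  have "4 * l\<^sup>2 * (T / 2 ^ n) * T - l * (264 * ?e) \<le> - 65 * real (Suc n)"
    unfolding var le by simp
  then have "2 * exp (4 * l\<^sup>2 * (T / 2 ^ n) * T - l * (264 * ?e)) \<le> 2 * exp (- 65 * real (Suc n))"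
    by simp
  moreover have "prob {\<omega>\<in>space M. 264 * ?e \<le> \<bar>(\<Sum>i<N. (W (v (Suc i)) \<omega> - W (v i) \<omega>)\<^sup>2) - (v N - v 0)\<bar>}
      \<le> 2 * exp (4 * l\<^sup>2 * (T / 2 ^ n) * T - l * (264 * ?e))"
    using v mono h T l lh by (intro prob_quadratic_variation_deviation) auto
  ultimately show ?thesis by linarith
qed

end

section \<open>Dyadic approximation and moduli of continuity\<close>

definition dyadic_floor :: "real \<Rightarrow> nat \<Rightarrow> real \<Rightarrow> nat" where
  "dyadic_floor T m t = nat \<lfloor>t * 2 ^ m / T\<rfloor>"

lemma dyadic_floor_lower:
  assumes "0 < T" "0 \<le> t"
  shows "real (dyadic_floor T m t) * (T / 2 ^ m) \<le> t"
proof -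
  have "real (dyadic_floor T m t) \<le> t * 2 ^ m / T"
    unfolding dyadic_floor_def using assms by (intro of_nat_floor) simp
  then show ?thesis using assms by (simp add: field_simps)
qed

lemma dyadic_floor_upper:
  assumes "0 < T" "0 \<le> t"
  shows "t < (real (dyadic_floor T m t) + 1) * (T / 2 ^ m)"
proof -
  have "t * 2 ^ m / T < real (dyadic_floor T m t) + 1"
    unfolding dyadic_floor_def by linarith
  then show ?thesis using assms by (simp add: field_simps)
qed

lemma dyadic_floor_le:
  assumes "0 < T" "t \<le> T"
  shows "dyadic_floor T m t \<le> 2 ^ m"
proof -
  have "t * 2 ^ m / T \<le> 2 ^ m" using assms by (simp add: field_simps)
  then have "\<lfloor>t * 2 ^ m / T\<rfloor> \<le> \<lfloor>2 ^ m :: real\<rfloor>" by (rule floor_mono)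
  then show ?thesis unfolding dyadic_floor_def by (simp add: nat_le_iff)
qed

lemma dyadic_floor_mono:
  assumes "0 < T" "s \<le> t"
  shows "dyadic_floor T m s \<le> dyadic_floor T m t"
  unfolding dyadic_floor_def using assms
  by (intro nat_mono floor_mono divide_right_mono mult_right_mono) auto

lemma le_dyadic_floor:
  assumes "0 < T" "real k * (T / 2 ^ m) \<le> t"
  shows "k \<le> dyadic_floor T m t"
proof -
  have "real k \<le> t * 2 ^ m / T" using assms by (simp add: field_simps)
  then show ?thesis unfolding dyadic_floor_def by (simp add: le_nat_floor)
qed

lemma dyadic_floor_close:
  assumes "0 < T" "0 \<le> s" "0 \<le> t" "\<bar>s - t\<bar> \<le> T / 2 ^ m"
  shows "dyadic_floor T m s \<le> Suc (dyadic_floor T m t)"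
proof -
  have "(real (dyadic_floor T m t) + 2) * (T / 2 ^ m) = (real (dyadic_floor T m t) + 1) * (T / 2 ^ m) + T / 2 ^ m"
    by (simp add: field_simps)
  then have "real (dyadic_floor T m s) * (T / 2 ^ m) < (real (dyadic_floor T m t) + 2) * (T / 2 ^ m)"
    using dyadic_floor_lower[of T s m] dyadic_floor_upper[of T t m] assms by linarith
  then have "real (dyadic_floor T m s) < real (dyadic_floor T m t) + 2"
    using assms(1) by (simp add: divide_simps)
  then show ?thesis by linarith
qed

lemma dyadic_floor_Suc:
  assumes "0 < T" "0 \<le> t"
  shows "dyadic_floor T (Suc m) t \<in> {2 * dyadic_floor T m t, Suc (2 * dyadic_floor T m t)}"
proof -
  have "real (dyadic_floor T (Suc m) t) * (T / 2 ^ Suc m) < (2 * real (dyadic_floor T m t) + 2) * (T / 2 ^ Suc m)"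
    using dyadic_floor_lower[of T t "Suc m"] dyadic_floor_upper[of T t m] assms
    by (simp add: field_simps)
  then have "real (dyadic_floor T (Suc m) t) < 2 * real (dyadic_floor T m t) + 2"
    using assms(1) by (simp add: divide_simps)
  moreover have "2 * dyadic_floor T m t \<le> dyadic_floor T (Suc m) t"
    using dyadic_floor_lower[OF assms, of m] assms
    by (intro le_dyadic_floor) (auto simp: field_simps)
  ultimately show ?thesis by auto
qed

text \<open>Kolmogorov's chaining: the dyadic approximations of a point converge to it, consecutive
  ones differ by at most one dyadic increment, and continuity passes the geometric series to the
  limit. Two points within \<open>T / 2 ^ m\<close> have equal or adjacent approximations at level
  m.\<close>

lemma geometric_modulus_from_dyadic_increments:
  fixes x :: "real \<Rightarrow> real"
  assumes T: "0 < T" and cont: "continuous_on {0..T} x" and \<rho>: "0 < \<rho>" "\<rho> < 1"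
    and inc: "\<And>m j. m \<ge> m0 \<Longrightarrow> j < 2 ^ m \<Longrightarrow>
      \<bar>x (real (Suc j) * (T / 2 ^ m)) - x (real j * (T / 2 ^ m))\<bar> \<le> c * \<rho> ^ m"
  obtains D where "0 \<le> D"
    and "\<And>m s t. s \<in> {0..T} \<Longrightarrow> t \<in> {0..T} \<Longrightarrow> \<bar>s - t\<bar> \<le> T / 2 ^ m \<Longrightarrow> \<bar>x s - x t\<bar> \<le> D * \<rho> ^ m"
proof -
  have "bounded (x ` {0..T})"
    using cont by (intro compact_imp_bounded compact_continuous_image) auto
  then obtain S where "\<forall>y\<in>x ` {0..T}. \<bar>y\<bar> \<le> S"
    unfolding bounded_real by blast
  then have S: "\<bar>x s\<bar> \<le> S" if "s \<in> {0..T}" for s using that by blast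
  have S0: "0 \<le> S" using S[of 0] T by simp
  \<comment> \<open>The second entry of the maximum covers the finitely many levels below
    \<open>m0\<close>, where increments are only known to be at most 2 S; the bound then holds at
    every level.\<close>
  define c' where "c' = max c (2 * S / \<rho> ^ m0)"
  have c': "c \<le> c'" "2 * S / \<rho> ^ m0 \<le> c'" by (simp_all add: c'_def)
  have "0 \<le> 2 * S / \<rho> ^ m0" using S0 \<rho> by simp
  with c' have c0: "0 \<le> c'" by linarith
  have grid: "real j * (T / 2 ^ m) \<in> {0..T}" if "j \<le> 2 ^ m" for j m
  proof -
    have "real j \<le> real (2 ^ m)" using that by (simp only: of_nat_le_iff)
    then have "real j * (T / 2 ^ m) \<le> 2 ^ m * (T / 2 ^ m)"
      using T by (intro mult_right_mono) auto
    then show ?thesis using T by simp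
  qed
  have inc': "\<bar>x (real (Suc j) * (T / 2 ^ m)) - x (real j * (T / 2 ^ m))\<bar> \<le> c' * \<rho> ^ m"
    if j: "j < 2 ^ m" for j m
  proof (cases "m0 \<le> m")
    case True
    have "c * \<rho> ^ m \<le> c' * \<rho> ^ m" using c'(1) \<rho> by (intro mult_right_mono) auto
    then show ?thesis using inc[OF True j] by linarith
  next
    case False
    have "\<bar>x (real (Suc j) * (T / 2 ^ m)) - x (real j * (T / 2 ^ m))\<bar> \<le> 2 * S / \<rho> ^ m0 * \<rho> ^ m0"
      using S[OF grid[of j m]] S[OF grid[of "Suc j" m]] j \<rho> by simp
    also have "\<dots> \<le> c' * \<rho> ^ m"
      using c'(2) False \<rho> c0 by (intro mult_mono power_decreasing) auto
    finally show ?thesis .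
  qed
  define d where "d m t = real (dyadic_floor T m t) * (T / 2 ^ m)" for m t
  have d: "d m t \<in> {0..T}" if "t \<in> {0..T}" for m t
    unfolding d_def using that dyadic_floor_le[OF T] by (intro grid) auto
  \<comment> \<open>Refining by one level either keeps the approximation or moves it to its right
    neighbour on the finer grid.\<close>
  have step: "\<bar>x (d (Suc m) t) - x (d m t)\<bar> \<le> c' * \<rho> ^ m" if t: "t \<in> {0..T}" for m t
  proof -
    let ?k = "dyadic_floor T m t"
    have double: "d m t = real (2 * ?k) * (T / 2 ^ Suc m)" by (simp add: d_def)
    have "\<bar>x (d (Suc m) t) - x (d m t)\<bar> \<le> c' * \<rho> ^ Suc m"
    proof (cases "dyadic_floor T (Suc m) t = 2 * ?k")
      case True
      then show ?thesis using c0 \<rho> unfolding double by (simp add: d_def)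
    next
      case False
      then have eq: "dyadic_floor T (Suc m) t = Suc (2 * ?k)"
        using dyadic_floor_Suc[of T t m] T t by auto
      then have "2 * ?k < 2 ^ Suc m"
        using dyadic_floor_le[of T t "Suc m"] T t by auto
      from inc'[OF this] show ?thesis unfolding double by (simp only: d_def eq)
    qed
    also have "\<dots> \<le> c' * \<rho> ^ m" using c0 \<rho> by (intro mult_left_mono power_decreasing) auto
    finally show ?thesis .
  qed
  \<comment> \<open>The last factor is the partial geometric sum 1 + \<rho> + ... + \<rho>^(p-1) in
    closed form, bounded by 1 / (1 - \<rho>) uniformly in p.\<close>
  have chain: "\<bar>x (d (m + p) t) - x (d m t)\<bar> \<le> c' * \<rho> ^ m * ((1 - \<rho> ^ p) / (1 - \<rho>))"
    if t: "t \<in> {0..T}" for m p t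
  proof (induction p)
    case (Suc p)
    have "\<bar>x (d (m + Suc p) t) - x (d m t)\<bar> \<le> c' * \<rho> ^ (m + p) + c' * \<rho> ^ m * ((1 - \<rho> ^ p) / (1 - \<rho>))"
      using step[OF t, of "m + p"] Suc by simp
    also have "\<dots> = c' * \<rho> ^ m * ((1 - \<rho> ^ Suc p) / (1 - \<rho>))"
      using \<rho> by (simp add: power_add divide_simps) (simp add: algebra_simps)
    finally show ?case .
  qed simp
  have approx: "\<bar>x t - x (d m t)\<bar> \<le> c' * \<rho> ^ m * (1 / (1 - \<rho>))" if t: "t \<in> {0..T}" for m t
  proof -
    have "(\<lambda>p. d (m + p) t) \<longlonglongrightarrow> t"
    proof (rule real_tendsto_sandwich)
      show "\<forall>\<^sub>F p in sequentially. t - T / 2 ^ (m + p) \<le> d (m + p) t"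
      proof (intro always_eventually allI)
        fix p
        have "t < d (m + p) t + T / 2 ^ (m + p)"
          using dyadic_floor_upper[OF T, of t "m + p"] t by (simp only: d_def ring_distribs) simp
        then show "t - T / 2 ^ (m + p) \<le> d (m + p) t" by linarith
      qed
      show "\<forall>\<^sub>F p in sequentially. d (m + p) t \<le> t"
        using dyadic_floor_lower[OF T, of t] t by (auto simp: d_def intro!: always_eventually)
      have "(\<lambda>p. T / 2 ^ m * (1/2) ^ p) \<longlonglongrightarrow> T / 2 ^ m * 0"
        by (intro tendsto_intros LIMSEQ_realpow_zero) auto
      then have "(\<lambda>p. t - T / 2 ^ m * (1/2) ^ p) \<longlonglongrightarrow> t - T / 2 ^ m * 0"
        by (intro tendsto_diff tendsto_const)
      then show "(\<lambda>p. t - T / 2 ^ (m + p)) \<longlonglongrightarrow> t" by (simp add: power_add power_divide)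
    qed simp
    then have "(\<lambda>p. x (d (m + p) t)) \<longlonglongrightarrow> x t"
      using cont t d by (intro continuous_on_tendsto_compose[OF cont]) auto
    then have "(\<lambda>p. \<bar>x (d (m + p) t) - x (d m t)\<bar>) \<longlonglongrightarrow> \<bar>x t - x (d m t)\<bar>"
      by (intro tendsto_intros)
    then show ?thesis
    proof (rule LIMSEQ_le_const2, intro exI[of _ 0] allI impI)
      fix p
      have "c' * \<rho> ^ m * ((1 - \<rho> ^ p) / (1 - \<rho>)) \<le> c' * \<rho> ^ m * (1 / (1 - \<rho>))"
        using c0 \<rho> by (intro mult_left_mono divide_right_mono) auto
      then show "\<bar>x (d (m + p) t) - x (d m t)\<bar> \<le> c' * \<rho> ^ m * (1 / (1 - \<rho>))"
        using chain[OF t, of m p] by linarith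
    qed
  qed
  show thesis
  proof (rule that[of "c' * (1 + 2 / (1 - \<rho>))"])
    show "0 \<le> c' * (1 + 2 / (1 - \<rho>))" using c0 \<rho> by simp
    fix m s t
    assume s: "s \<in> {0..T}" and t: "t \<in> {0..T}" and st: "\<bar>s - t\<bar> \<le> T / 2 ^ m"
    have adjacent: "\<bar>x (d m r) - x (d m r')\<bar> \<le> c' * \<rho> ^ m"
      if r: "r \<in> {0..T}" and r': "r' \<in> {0..T}" and le: "dyadic_floor T m r' \<le> dyadic_floor T m r"
        and rr: "\<bar>r - r'\<bar> \<le> T / 2 ^ m" for r r'
    proof (cases "dyadic_floor T m r = dyadic_floor T m r'")
      case True
      then show ?thesis using c0 \<rho> by (simp add: d_def)
    next
      case False
      then have eq: "dyadic_floor T m r = Suc (dyadic_floor T m r')"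
        using dyadic_floor_close[of T r r' m] T r r' le rr by auto
      then have "dyadic_floor T m r' < 2 ^ m" using dyadic_floor_le[of T r m] T r by auto
      from inc'[OF this] show ?thesis unfolding d_def eq .
    qed
    have "\<bar>x (d m s) - x (d m t)\<bar> \<le> c' * \<rho> ^ m"
      using adjacent[of s t] adjacent[of t s] s t st
      by (cases "dyadic_floor T m t \<le> dyadic_floor T m s") (auto simp: abs_minus_commute)
    then have "\<bar>x s - x t\<bar> \<le> c' * \<rho> ^ m + 2 * (c' * \<rho> ^ m * (1 / (1 - \<rho>)))"
      using approx[OF s, of m] approx[OF t, of m] by linarith
    also have "\<dots> = c' * (1 + 2 / (1 - \<rho>)) * \<rho> ^ m" by (simp add: algebra_simps)
    finally show "\<bar>x s - x t\<bar> \<le> c' * (1 + 2 / (1 - \<rho>)) * \<rho> ^ m" .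
  qed
qed

section \<open>Shifted grids as clamped arithmetic progressions\<close>

text \<open>The index is shifted by one so that, for \<open>0 \<le> a \<le> l\<close>, the point with index \<open>0\<close> is clamped to \<open>0\<close>.\<close>

definition grid_point :: "real \<Rightarrow> real \<Rightarrow> real \<Rightarrow> nat \<Rightarrow> real" where
  "grid_point l a t k = max 0 (min t (a + (real k - 1) * l))"

definition grid_energy :: "nat \<Rightarrow> (real \<Rightarrow> real) \<Rightarrow> real \<Rightarrow> real \<Rightarrow> real \<Rightarrow> real" where
  "grid_energy N x l a t = (\<Sum>k<N. (x (grid_point l a t (Suc k)) - x (grid_point l a t k))\<^sup>2)"

lemma grid_point_mem: "t \<in> {0..T} \<Longrightarrow> grid_point l a t k \<in> {0..T}"
  by (auto simp: grid_point_def)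

lemma grid_point_0: "0 \<le> t \<Longrightarrow> a \<le> l \<Longrightarrow> grid_point l a t 0 = 0"
  by (simp add: grid_point_def)

lemma grid_point_last: "0 \<le> t \<Longrightarrow> t \<le> a + (real k - 1) * l \<Longrightarrow> grid_point l a t k = t"
  by (simp add: grid_point_def)

lemma grid_point_Suc:
  assumes "0 \<le> l"
  shows "grid_point l a t k \<le> grid_point l a t (Suc k)"
    and "grid_point l a t (Suc k) - grid_point l a t k \<le> l"
  using assms by (auto simp: grid_point_def max_def min_def algebra_simps)

lemma grid_point_min: "t \<in> {0..T} \<Longrightarrow> min (grid_point l a T k) t = grid_point l a t k"
  by (auto simp: grid_point_def max_def min_def)

text \<open>Clamping is 1-Lipschitz in the clamped value and in \<open>t\<close>, so it remains to
  compare the affine expressions; there the error of the mesh is multiplied by |k - 1| \<le>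
  N.\<close>

lemma grid_point_perturb:
  assumes "\<bar>l - l'\<bar> \<le> \<eta>" "\<bar>a - a'\<bar> \<le> \<eta>" "\<bar>t - t'\<bar> \<le> \<eta>" "k \<le> N" "1 \<le> N"
  shows "\<bar>grid_point l a t k - grid_point l' a' t' k\<bar> \<le> (real N + 1) * \<eta>"
proof -
  have \<eta>: "0 \<le> \<eta>" using assms(1) by linarith
  have "\<bar>(real k - 1) * (l - l')\<bar> \<le> real N * \<eta>"
    unfolding abs_mult using assms \<eta> by (intro mult_mono) auto
  then have "\<bar>(a + (real k - 1) * l) - (a' + (real k - 1) * l')\<bar> \<le> (real N + 1) * \<eta>"
    using assms(2) by (simp add: algebra_simps)
  moreover have "1 * \<eta> \<le> (real N + 1) * \<eta>"
    using \<eta> by (intro mult_right_mono) auto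
  then have "\<bar>t - t'\<bar> \<le> (real N + 1) * \<eta>" using assms(3) by linarith
  ultimately show ?thesis unfolding grid_point_def by linarith
qed

text \<open>Index 0 is clamped to 0, and the lower bound on \<open>N\<close> makes index
  \<open>N\<close> clamp to \<open>T\<close>. All other indices give interior grid points or repeat
  an endpoint.\<close>

lemma shifted_grid_eq_image:
  assumes l: "0 < l" and a: "0 \<le> a" "a < l" and T: "0 \<le> T" "T \<le> a + (real N - 1) * l"
  shows "shifted_grid T l a = grid_point l a T ` {..N}"
proof (intro equalityI subsetI)
  fix s assume "s \<in> shifted_grid T l a"
  then consider "s = 0" | "s = T" | k where "s = a + of_int k * l" "0 < s" "s < T"
    by (auto simp: shifted_grid_def)
  then show "s \<in> grid_point l a T ` {..N}"
  proof cases
    case 1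
    then show ?thesis using grid_point_0[of T a l] a T by (intro image_eqI[of _ _ 0]) auto
  next
    case 2
    then show ?thesis using grid_point_last[of T a N l] T by (intro image_eqI[of _ _ N]) auto
  next
    case (3 k)
    \<comment> \<open>Since a < l, an interior point cannot have a negative k; this makes the
      natural index k + 1 available.\<close>
    have "- l < of_int k * l" using 3 a by linarith
    then have "of_int (- 1) * l < of_int k * l" by simp
    then have k: "0 \<le> k" using l by (simp only: mult_less_cancel_right_pos of_int_less_iff)
    have "of_int k * l < (real N - 1) * l" using 3 T by linarith
    then have "of_int k < real N - 1" using l by (simp only: mult_less_cancel_right_pos)
    then have "nat (k + 1) \<le> N" using k by linarith
    moreover have "real (nat (k + 1)) - 1 = of_int k" using k by simp
    then have "s = grid_point l a T (nat (k + 1))" using 3 by (simp add: grid_point_def)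
    ultimately show ?thesis by auto
  qed
next
  fix s assume "s \<in> grid_point l a T ` {..N}"
  then obtain k where "s = grid_point l a T k" by auto
  then have "s = max 0 (min T (a + of_int (int k - 1) * l))" by (simp add: grid_point_def)
  moreover have "max 0 (min T c) = 0 \<or> max 0 (min T c) = T \<or> (max 0 (min T c) = c \<and> 0 < c \<and> c < T)" for c :: real
    using T by linarith
  ultimately have "s = 0 \<or> s = T \<or> (s = a + of_int (int k - 1) * l \<and> 0 < s \<and> s < T)" by metis
  then show "s \<in> shifted_grid T l a" unfolding shifted_grid_def by blast
qed

text \<open>Stopping at \<open>t\<close> amounts to clamping the grid at \<open>t\<close> instead of
  \<open>T\<close>. The number of terms can be fixed for all meshes above a given size, whatever the
  offset and the time, which permits comparison of different parameters term by term.\<close>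

lemma stopped_energy_shifted_grid:
  assumes "0 < l" "0 \<le> a" "a < l" "T \<le> a + (real N - 1) * l" and t: "t \<in> {0..T}"
  shows "stopped_energy (shifted_grid T l a) x t = grid_energy N x l a t"
proof -
  have "stopped_energy (shifted_grid T l a) x t = stopped_energy (grid_point l a T ` {..N}) x t"
    using assms by (subst shifted_grid_eq_image) auto
  also have "\<dots> = grid_energy N x l a t"
    using assms grid_point_Suc(1)[of l a T]
    by (subst stopped_energy_monotone_enumeration) (auto simp: grid_energy_def grid_point_min[OF t])
  finally show ?thesis .
qed

text \<open>Each term uses A^2 - B^2 = (A - B) (A + B), where the difference is at most 2 \<epsilon>
  and the sum at most 2 D.\<close>

lemma sum_square_increments_perturb:
  fixes x :: "real \<Rightarrow> real" and u v :: "nat \<Rightarrow> real"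
  assumes mem: "\<And>k. k \<le> N \<Longrightarrow> u k \<in> {0..T}" "\<And>k. k \<le> N \<Longrightarrow> v k \<in> {0..T}"
    and osc: "\<And>s t. s \<in> {0..T} \<Longrightarrow> t \<in> {0..T} \<Longrightarrow> \<bar>x s - x t\<bar> \<le> D"
    and close: "\<And>k. k \<le> N \<Longrightarrow> \<bar>x (u k) - x (v k)\<bar> \<le> \<epsilon>" and "0 \<le> T"
  shows "\<bar>(\<Sum>k<N. (x (u (Suc k)) - x (u k))\<^sup>2) - (\<Sum>k<N. (x (v (Suc k)) - x (v k))\<^sup>2)\<bar> \<le> real N * (4 * D * \<epsilon>)"
proof -
  have D: "0 \<le> D" using osc[of 0 0] \<open>0 \<le> T\<close> by simp
  have "\<bar>(x (u (Suc k)) - x (u k))\<^sup>2 - (x (v (Suc k)) - x (v k))\<^sup>2\<bar> \<le> 4 * D * \<epsilon>" if k: "k < N" for k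
  proof -
    let ?A = "x (u (Suc k)) - x (u k)" and ?B = "x (v (Suc k)) - x (v k)"
    have "\<bar>?A - ?B\<bar> \<le> 2 * \<epsilon>" using close[of k] close[of "Suc k"] k by auto
    moreover have "\<bar>?A + ?B\<bar> \<le> 2 * D"
      using osc[OF mem(1) mem(1), of "Suc k" k] osc[OF mem(2) mem(2), of "Suc k" k] k by auto
    ultimately have "\<bar>?A - ?B\<bar> * \<bar>?A + ?B\<bar> \<le> (2 * \<epsilon>) * (2 * D)"
      by (intro mult_mono) auto
    moreover have "?A\<^sup>2 - ?B\<^sup>2 = (?A - ?B) * (?A + ?B)" by (simp add: power2_eq_square algebra_simps)
    ultimately show ?thesis by (simp add: abs_mult mult_ac)
  qed
  then have "(\<Sum>k<N. \<bar>(x (u (Suc k)) - x (u k))\<^sup>2 - (x (v (Suc k)) - x (v k))\<^sup>2\<bar>) \<le> (\<Sum>k<N. 4 * D * \<epsilon>)"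
    by (intro sum_mono) auto
  then show ?thesis
    unfolding sum_subtractf[symmetric] by (intro order_trans[OF sum_abs]) simp
qed

section \<open>Borel--Cantelli over finite nets\<close>

text \<open>A union bound: 2^(64 (n + 1)) \<le> e^(64 (n + 1)) events against the rate 65 leave a
  summable multiple of e^(-n).\<close>

lemma (in prob_space) AE_eventually_finite_family:
  assumes A: "\<And>n i. i \<in> I n \<Longrightarrow> A n i \<in> sets M"
    and I: "\<And>n. finite (I n)" "\<And>n. card (I n) \<le> 2 ^ (64 * Suc n)"
    and p: "\<And>n i. i \<in> I n \<Longrightarrow> prob (A n i) \<le> 2 * exp (- 65 * real (Suc n))"
  shows "AE \<omega> in M. \<forall>\<^sub>F n in sequentially. \<forall>i\<in>I n. \<omega> \<notin> A n i"
proof -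
  let ?B = "\<lambda>n. \<Union>i\<in>I n. A n i"
  have B: "?B n \<in> sets M" for n using I A by auto
  have bound: "prob (?B n) \<le> 2 * exp (- 1) ^ n" for n
  proof -
    have "prob (?B n) \<le> (\<Sum>i\<in>I n. prob (A n i))"
      using I A by (intro finite_measure_subadditive_finite) auto
    also have "\<dots> \<le> real (card (I n)) * (2 * exp (- 65 * real (Suc n)))"
      using p by (intro sum_bounded_above) auto
    also have "\<dots> \<le> exp (64 * real (Suc n)) * (2 * exp (- 65 * real (Suc n)))"
    proof (rule mult_right_mono)
      have "real (card (I n)) \<le> real (2 ^ (64 * Suc n))" using I(2)[of n] by (simp only: of_nat_le_iff)
      also have "\<dots> = 2 ^ (64 * Suc n)" by simp
      also have "\<dots> \<le> exp 1 ^ (64 * Suc n)" using exp_ge_add_one_self[of 1] by (intro power_mono) auto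
      also have "\<dots> = exp (64 * real (Suc n))" by (simp flip: exp_of_nat_mult)
      finally show "real (card (I n)) \<le> exp (64 * real (Suc n))" .
    qed simp
    also have "\<dots> = 2 * exp (- real (Suc n))" by (simp add: algebra_simps flip: exp_add)
    also have "\<dots> \<le> 2 * exp (- real n)" by simp
    also have "\<dots> = 2 * exp (- 1) ^ n" by (simp flip: exp_of_nat_mult)
    finally show ?thesis .
  qed
  have "summable (\<lambda>n. 2 * exp (- 1 :: real) ^ n)"
    by (intro summable_mult summable_geometric) simp
  then have "summable (\<lambda>n. prob (?B n))"
    by (rule summable_comparison_test_ev[rotated]) (use bound in simp)
  then have "AE \<omega> in M. \<forall>\<^sub>F n in sequentially. \<omega> \<in> space M - ?B n"
    using B by (intro borel_cantelli_AE1) (auto simp: emeasure_eq_measure)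
  then show ?thesis by (elim eventually_mono) auto
qed

context standard_brownian_motion
begin

text \<open>A single dyadic increment is the quadratic variation of a one-interval partition, so the
  deviation estimate also bounds its square, by a multiple of
  \<open>level_error T m\<close>.\<close>

lemma AE_dyadic_increments:
  assumes T: "0 < T"
  shows "AE \<omega> in M. \<forall>\<^sub>F m in sequentially. \<forall>j<2 ^ m.
    \<bar>W (real (Suc j) * (T / 2 ^ m)) \<omega> - W (real j * (T / 2 ^ m)) \<omega>\<bar>
      \<le> sqrt (530 * T) * sqrt (sqrt (3/4)) ^ m"
proof -
  let ?t = "\<lambda>m j. real j * (T / 2 ^ m)"
  let ?v = "\<lambda>m j i. ?t m (j + i)"
  let ?Z = "\<lambda>m j \<omega>. (\<Sum>i<1. (W (?v m j (Suc i)) \<omega> - W (?v m j i) \<omega>)\<^sup>2) - (?v m j 1 - ?v m j 0)"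
  let ?A = "\<lambda>m j. {\<omega>\<in>space M. 264 * level_error T m \<le> \<bar>?Z m j \<omega>\<bar>}"
  have mem: "?t m j \<in> {0..T}" if "j \<le> 2 ^ m" for m j
  proof -
    have "real j \<le> real (2 ^ m)" using that by (simp only: of_nat_le_iff)
    then have "?t m j \<le> 2 ^ m * (T / 2 ^ m)" using T by (intro mult_right_mono) auto
    then show ?thesis using T by simp
  qed
  have "AE \<omega> in M. \<forall>\<^sub>F m in sequentially. \<forall>j\<in>{..<2 ^ m}. \<omega> \<notin> ?A m j"
  proof (rule AE_eventually_finite_family)
    fix m j :: nat assume j: "j \<in> {..<2 ^ m}"
    have [measurable]: "random_variable borel (W (?v m j i))" if "i \<le> 1" for i
      using mem[of "j + i" m] that j by (intro random_variable) auto
    show "?A m j \<in> sets M" by measurable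
    show "prob (?A m j) \<le> 2 * exp (- 65 * real (Suc m))"
    proof (rule prob_quadratic_variation_level[OF T])
      show "?v m j i \<in> {0..T}" if "i \<le> 1" for i using that j by (intro mem) auto
      show "?v m j i \<le> ?v m j (Suc i)" for i using T by (intro mult_right_mono) auto
      show "?v m j (Suc i) - ?v m j i \<le> T / 2 ^ m" for i
        by (simp add: add_divide_distrib ring_distribs)
    qed
  qed (auto intro: power_increasing)
  then show ?thesis
  proof (rule AE_mp, intro AE_I2 impI)
    fix \<omega> assume \<omega>: "\<omega> \<in> space M" and "\<forall>\<^sub>F m in sequentially. \<forall>j\<in>{..<2 ^ m}. \<omega> \<notin> ?A m j"
    from this(2) show "\<forall>\<^sub>F m in sequentially. \<forall>j<2 ^ m.
      \<bar>W (?t m (Suc j)) \<omega> - W (?t m j) \<omega>\<bar> \<le> sqrt (530 * T) * sqrt (sqrt (3/4)) ^ m"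
    proof (elim eventually_mono, intro allI impI)
      fix m j :: nat
      assume "\<forall>j\<in>{..<2 ^ m}. \<omega> \<notin> ?A m j" and "j < 2 ^ m"
      let ?d = "W (?t m (Suc j)) \<omega> - W (?t m j) \<omega>"
      have "\<omega> \<notin> ?A m j" using \<open>\<forall>j\<in>_. _\<close> \<open>j < _\<close> by blast
      then have "\<bar>?Z m j \<omega>\<bar> < 264 * level_error T m" using \<omega> by (simp add: not_le)
      moreover have "?v m j 1 - ?v m j 0 = T / 2 ^ m" by (simp add: add_divide_distrib ring_distribs)
      ultimately have "\<bar>?d\<^sup>2 - T / 2 ^ m\<bar> < 264 * level_error T m" by simp
      \<comment> \<open>The centring term \<open>T / 2 ^ m\<close> raises 264 to 265, and the factor
        2 of the geometric bound on \<open>level_error\<close> gives 530 under the root.\<close>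
      then have "?d\<^sup>2 \<le> 264 * level_error T m + T / 2 ^ m"
        by linarith
      also have "\<dots> \<le> 265 * level_error T m" using level_error_ge'[of T m] T by simp
      also have "\<dots> \<le> 265 * (2 * T * sqrt (3/4) ^ m)"
        using level_error_geometric[of T m] T by simp
      also have "\<dots> = (sqrt (530 * T) * sqrt (sqrt (3/4)) ^ m)\<^sup>2"
      proof -
        have square: "(sqrt (530 * T) * sqrt (sqrt c) ^ m)\<^sup>2 = 265 * (2 * T * sqrt c ^ m)" if "0 \<le> c" for c
        proof -
          have "(sqrt (sqrt c) ^ m)\<^sup>2 = ((sqrt (sqrt c))\<^sup>2) ^ m"
            by (simp only: power_mult[symmetric] mult.commute)
          then show ?thesis using T that by (simp add: power_mult_distrib)
        qed
        show ?thesis by (rule square[symmetric]) simp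
      qed
      finally have "\<bar>?d\<bar>\<^sup>2 \<le> (sqrt (530 * T) * sqrt (sqrt (3/4)) ^ m)\<^sup>2" by (simp only: power2_abs)
      then show "\<bar>?d\<bar> \<le> sqrt (530 * T) * sqrt (sqrt (3/4)) ^ m"
        by (rule power2_le_imp_le) (use T in simp)
    qed
  qed
qed

text \<open>This is Hoelder continuity with a small exponent: the ratio is (3/4)^(1/4) per halving
  of the distance. A small exponent is enough because the nets below can be taken polynomially finer
  than the mesh.\<close>

lemma AE_geometric_modulus:
  assumes T: "0 < T"
  shows "AE \<omega> in M. \<exists>D\<ge>0. \<forall>m. \<forall>s\<in>{0..T}. \<forall>t\<in>{0..T}. \<bar>s - t\<bar> \<le> T / 2 ^ m \<longrightarrow>
    \<bar>W s \<omega> - W t \<omega>\<bar> \<le> D * sqrt (sqrt (3/4)) ^ m"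
  using continuous_paths AE_dyadic_increments[OF T]
proof eventually_elim
  case (elim \<omega>)
  then obtain m0 where m0: "\<And>m j. m \<ge> m0 \<Longrightarrow> j < 2 ^ m \<Longrightarrow>
      \<bar>W (real (Suc j) * (T / 2 ^ m)) \<omega> - W (real j * (T / 2 ^ m)) \<omega>\<bar> \<le> sqrt (530 * T) * sqrt (sqrt (3/4)) ^ m"
    unfolding eventually_sequentially by blast
  have "sqrt (sqrt (3/4)) < 1" "0 < sqrt (sqrt (3/4))"
    by (simp_all add: real_sqrt_lt_1_iff)
  from geometric_modulus_from_dyadic_increments[of T "\<lambda>t. W t \<omega>", OF T elim(1) this(2,1) m0]
  show ?case by metis
qed

text \<open>The resolution \<open>21 n + 3\<close> makes grid points of the net \<open>T / 2 ^ (20 n)\<close>-close to those of the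
  given grid; \<open>2 ^ (n + 2)\<close> terms then contribute an error of order
  \<open>2 ^ n * (3/4) ^ (5 n) \<le> 2 ^ (- n)\<close>.\<close>

lemma AE_grid_energy_net:
  assumes T: "0 < T"
  defines "\<eta> \<equiv> \<lambda>n. T / 2 ^ (21 * n + 3)"
  shows "AE \<omega> in M. \<forall>\<^sub>F n in sequentially. \<forall>i\<le>2 ^ (21 * n + 3). \<forall>j\<le>2 ^ (21 * n + 3). \<forall>k\<le>2 ^ (21 * n + 3).
    T / 2 ^ Suc n \<le> real i * \<eta> n \<longrightarrow> real i * \<eta> n \<le> T / 2 ^ n \<longrightarrow> j \<le> i \<longrightarrow>
    \<bar>grid_energy (Suc (2 ^ Suc n)) (\<lambda>s. W s \<omega>) (real i * \<eta> n) (real j * \<eta> n) (real k * \<eta> n) - real k * \<eta> n\<bar>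
      < 264 * level_error T n"
proof -
  let ?q = "\<lambda>n. 21 * n + 3 :: nat" and ?N = "\<lambda>n. Suc (2 ^ Suc n) :: nat"
  \<comment> \<open>The condition on offsets is the closed one, j \<le> i, since rounding both
    parameters down can turn a < l into equality.\<close>
  define I where "I n = {(i, j, k :: nat). i \<le> 2 ^ ?q n \<and> j \<le> 2 ^ ?q n \<and> k \<le> 2 ^ ?q n \<and>
    T / 2 ^ Suc n \<le> real i * \<eta> n \<and> real i * \<eta> n \<le> T / 2 ^ n \<and> j \<le> i}" for n
  let ?A = "\<lambda>n (i, j, k). {\<omega>\<in>space M. 264 * level_error T n \<le>
    \<bar>grid_energy (?N n) (\<lambda>s. W s \<omega>) (real i * \<eta> n) (real j * \<eta> n) (real k * \<eta> n) - real k * \<eta> n\<bar>}"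
  have \<eta>: "0 < \<eta> n" for n using T by (simp add: \<eta>_def)
  have sub: "I n \<subseteq> {..2 ^ ?q n} \<times> {..2 ^ ?q n} \<times> {..2 ^ ?q n}" for n by (auto simp: I_def)
  have "AE \<omega> in M. \<forall>\<^sub>F n in sequentially. \<forall>p\<in>I n. \<omega> \<notin> ?A n p"
  proof (rule AE_eventually_finite_family)
    fix n
    show "finite (I n)" using sub by (rule finite_subset) simp
    \<comment> \<open>Three parameters with at most 2^(21 n + 4) values each give the exponent 63 n
      + 12 \<le> 64 (n + 1).\<close>
    have "card (I n) \<le> card ({..2 ^ ?q n :: nat} \<times> {..2 ^ ?q n :: nat} \<times> {..2 ^ ?q n :: nat})"
      using sub by (intro card_mono) auto
    also have "\<dots> = Suc (2 ^ ?q n) ^ 3" by (simp add: card_cartesian_product power3_eq_cube)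
    also have "\<dots> \<le> (2 ^ (?q n + 1)) ^ 3"
    proof (rule power_mono)
      have "Suc (2 ^ q) \<le> 2 ^ (q + 1)" for q :: nat by simp
      then show "Suc (2 ^ ?q n) \<le> 2 ^ (?q n + 1)" .
    qed simp
    also have "\<dots> = 2 ^ ((?q n + 1) * 3)" by (rule power_mult[symmetric])
    also have "\<dots> \<le> 2 ^ (64 * Suc n)" by (intro power_increasing) simp_all
    finally show "card (I n) \<le> 2 ^ (64 * Suc n)" .
  next
    fix n p assume p: "p \<in> I n"
    obtain i j k where ijk: "p = (i, j, k)" by (cases p) auto
    define l a t where "l = real i * \<eta> n" and "a = real j * \<eta> n" and "t = real k * \<eta> n"
    have l: "T / 2 ^ Suc n \<le> l" "l \<le> T / 2 ^ n" using p by (auto simp: I_def ijk l_def)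
    have a: "0 \<le> a" "a \<le> l" using p \<eta>[of n] by (auto simp: I_def ijk l_def a_def)
    have "real k \<le> real (2 ^ ?q n)" using p by (simp only: of_nat_le_iff) (simp add: I_def ijk)
    then have "t \<le> 2 ^ ?q n * \<eta> n" unfolding t_def using \<eta>[of n] by (intro mult_right_mono) auto
    then have "t \<le> T" by (simp add: \<eta>_def)
    moreover have "0 \<le> t" using \<eta>[of n] by (simp add: t_def)
    ultimately have t: "0 \<le> t" "t \<le> T" by simp_all
    have A: "?A n p = {\<omega>\<in>space M. 264 * level_error T n \<le> \<bar>grid_energy (?N n) (\<lambda>s. W s \<omega>) l a t - t\<bar>}"
      by (simp add: ijk l_def a_def t_def)
    have [measurable]: "random_variable borel (W (grid_point l a t k))" for k
      using t by (intro random_variable grid_point_mem) auto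
    show "?A n p \<in> sets M" unfolding A unfolding grid_energy_def by measurable
    have l0: "0 \<le> l" using a by linarith
    \<comment> \<open>Because of the index shift, the last of the \<open>?N n\<close> steps ends
      2^(n + 1) meshes beyond the offset, hence at or beyond T, and is clamped to
      \<open>t\<close>.\<close>
    have "2 ^ Suc n * (T / 2 ^ Suc n) \<le> 2 ^ Suc n * l" using l by (intro mult_left_mono) auto
    then have "grid_point l a t (?N n) = t" using t a by (intro grid_point_last) auto
    moreover have "grid_point l a t 0 = 0" using t a by (intro grid_point_0) auto
    ultimately have "t = grid_point l a t (?N n) - grid_point l a t 0" by simp
    then show "prob (?A n p) \<le> 2 * exp (- 65 * real (Suc n))"
      unfolding A unfolding grid_energy_def
      using prob_quadratic_variation_level[of "?N n" "grid_point l a t" n]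
        T t grid_point_mem[of t T l a] grid_point_Suc[OF l0, of a t] order_trans[OF grid_point_Suc(2)[OF l0] l(2)]
      by auto
  qed
  then show ?thesis
  proof (rule AE_mp, intro AE_I2 impI)
    fix \<omega> assume \<omega>: "\<omega> \<in> space M" and "\<forall>\<^sub>F n in sequentially. \<forall>p\<in>I n. \<omega> \<notin> ?A n p"
    from this(2) show "\<forall>\<^sub>F n in sequentially. \<forall>i\<le>2 ^ ?q n. \<forall>j\<le>2 ^ ?q n. \<forall>k\<le>2 ^ ?q n.
      T / 2 ^ Suc n \<le> real i * \<eta> n \<longrightarrow> real i * \<eta> n \<le> T / 2 ^ n \<longrightarrow> j \<le> i \<longrightarrow>
      \<bar>grid_energy (?N n) (\<lambda>s. W s \<omega>) (real i * \<eta> n) (real j * \<eta> n) (real k * \<eta> n) - real k * \<eta> n\<bar>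
        < 264 * level_error T n"
    proof (elim eventually_mono, intro allI impI)
      fix n i j k :: nat
      assume *: "\<forall>p\<in>I n. \<omega> \<notin> ?A n p" "i \<le> 2 ^ ?q n" "j \<le> 2 ^ ?q n" "k \<le> 2 ^ ?q n"
        "T / 2 ^ Suc n \<le> real i * \<eta> n" "real i * \<eta> n \<le> T / 2 ^ n" "j \<le> i"
      then have "(i, j, k) \<in> I n" by (simp add: I_def)
      with *(1) have "\<omega> \<notin> ?A n (i, j, k)" by blast
      then show "\<bar>grid_energy (?N n) (\<lambda>s. W s \<omega>) (real i * \<eta> n) (real j * \<eta> n) (real k * \<eta> n) - real k * \<eta> n\<bar>
          < 264 * level_error T n"
        using \<omega> by (simp add: not_le)
    qed
  qed
qed

end

section \<open>From the net to all parameters\<close>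

text \<open>All three parameters are rounded down to multiples of \<eta>. Rounding is monotone, so a
  \<le> l survives, and \<open>l\<close> stays above \<open>T / 2 ^ Suc n\<close> because that
  number is itself a multiple of \<eta>. The modulus controls the change of the energy; rounding
  \<open>t\<close> in the centring raises 264 to 265.\<close>

lemma grid_energy_level_bound:
  assumes T: "0 < T"
    and net: "\<And>i j k. i \<le> 2 ^ (21 * n + 3) \<Longrightarrow> j \<le> 2 ^ (21 * n + 3) \<Longrightarrow> k \<le> 2 ^ (21 * n + 3) \<Longrightarrow>
      T / 2 ^ Suc n \<le> real i * \<eta> \<Longrightarrow> real i * \<eta> \<le> T / 2 ^ n \<Longrightarrow> j \<le> i \<Longrightarrow>
      \<bar>grid_energy (Suc (2 ^ Suc n)) x (real i * \<eta>) (real j * \<eta>) (real k * \<eta>) - real k * \<eta>\<bar> < 264 * level_error T n"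
    and \<eta>: "\<eta> = T / 2 ^ (21 * n + 3)"
    and modulus: "\<And>m s t. s \<in> {0..T} \<Longrightarrow> t \<in> {0..T} \<Longrightarrow> \<bar>s - t\<bar> \<le> T / 2 ^ m \<Longrightarrow>
      \<bar>x s - x t\<bar> \<le> D * sqrt (sqrt (3/4)) ^ m"
    and l: "T / 2 ^ Suc n \<le> l" "l \<le> T / 2 ^ n" and a: "0 \<le> a" "a \<le> l" and t: "t \<in> {0..T}"
  shows "\<bar>grid_energy (Suc (2 ^ Suc n)) x l a t - t\<bar> \<le> (16 * D\<^sup>2 / T + 265) * level_error T n"
proof -
  let ?q = "21 * n + 3" and ?N = "Suc (2 ^ Suc n) :: nat"
  let ?f = "dyadic_floor T ?q"
  have \<eta>0: "0 < \<eta>" using T by (simp add: \<eta>)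
  have "T / 2 ^ n \<le> T / 1" using T by (intro divide_left_mono) auto
  then have lT: "0 < l" "l \<le> T" using l T by (auto intro: less_le_trans[of 0 "T / 2 ^ Suc n"])
  have low: "real (?f s) * \<eta> \<le> s" and upp: "s \<le> real (?f s) * \<eta> + \<eta>" if "0 \<le> s" for s
    using dyadic_floor_lower[OF T that, of ?q] dyadic_floor_upper[OF T that, of ?q]
    by (simp_all only: \<eta> ring_distribs)
  have close: "\<bar>s - real (?f s) * \<eta>\<bar> \<le> \<eta>" if "0 \<le> s" for s
    using low[OF that] upp[OF that] by linarith
  have scale: "T / 2 ^ Suc n = real (2 ^ (20 * n + 2)) * \<eta>"
  proof -
    have "(2::real) ^ ?q = 2 ^ (20 * n + 2) * 2 ^ Suc n"
      by (simp flip: power_add) (simp add: power_add)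
    then show ?thesis by (simp add: \<eta>)
  qed
  have "2 ^ (20 * n + 2) \<le> ?f l"
    using l(1) scale T by (intro le_dyadic_floor) (auto simp: \<eta>)
  then have "real (2 ^ (20 * n + 2)) \<le> real (?f l)" by (simp only: of_nat_le_iff)
  then have fl: "T / 2 ^ Suc n \<le> real (?f l) * \<eta>"
    unfolding scale using \<eta>0 by (intro mult_right_mono) auto
  have main: "\<bar>grid_energy ?N x (real (?f l) * \<eta>) (real (?f a) * \<eta>) (real (?f t) * \<eta>) - real (?f t) * \<eta>\<bar>
      < 264 * level_error T n"
    using T lT a t l fl low[of l] by (intro net dyadic_floor_le dyadic_floor_mono) auto
  have ft: "real (?f t) * \<eta> \<in> {0..T}" using low[of t] t \<eta>0 by auto
  \<comment> \<open>In the resolution 21 n + 3, the factor 8 = 2^3 uses up the 3 and the factor 2^n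
    reduces 21 n to 20 n.\<close>
  have N: "(real ?N + 1) * \<eta> \<le> T / 2 ^ (20 * n)"
  proof -
    have "(1::real) \<le> 2 ^ n" by simp
    moreover have "real ?N = 1 + 2 * 2 ^ n" by simp
    ultimately have "real ?N + 1 \<le> 8 * 2 ^ n" by linarith
    then have "(real ?N + 1) * \<eta> \<le> 8 * 2 ^ n * \<eta>" using \<eta>0 by (intro mult_right_mono) auto
    also have "\<dots> = T / 2 ^ (20 * n)"
    proof -
      have "(2::real) ^ ?q = 2 ^ (20 * n) * 2 ^ n * 2 ^ 3"
        by (simp flip: power_add) (simp add: power_add)
      then show ?thesis by (simp add: \<eta>)
    qed
    finally show ?thesis .
  qed
  let ?u = "grid_point l a t" and ?v = "grid_point (real (?f l) * \<eta>) (real (?f a) * \<eta>) (real (?f t) * \<eta>)"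
  have "\<bar>grid_energy ?N x l a t - grid_energy ?N x (real (?f l) * \<eta>) (real (?f a) * \<eta>) (real (?f t) * \<eta>)\<bar>
      \<le> real ?N * (4 * D * (D * sqrt (sqrt (3/4)) ^ (20 * n)))"
    unfolding grid_energy_def
  proof (rule sum_square_increments_perturb[where u = ?u and v = ?v and T = T])
    show "?u k \<in> {0..T}" "?v k \<in> {0..T}" for k
      by (rule grid_point_mem[OF t], rule grid_point_mem[OF ft])
    show "\<bar>x s - x r\<bar> \<le> D" if "s \<in> {0..T}" "r \<in> {0..T}" for s r
      using modulus[OF that, of 0] that by auto
    show "\<bar>x (?u k) - x (?v k)\<bar> \<le> D * sqrt (sqrt (3/4)) ^ (20 * n)" if "k \<le> ?N" for k
    proof (rule modulus)
      show "\<bar>?u k - ?v k\<bar> \<le> T / 2 ^ (20 * n)"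
        using that lT a t close by (intro order_trans[OF grid_point_perturb N]) auto
    qed (rule grid_point_mem[OF t] grid_point_mem[OF ft])+
  qed (use T in simp)
  also have "\<dots> = real ?N * sqrt (sqrt (3/4)) ^ (20 * n) * (4 * D\<^sup>2)"
    by (simp add: power2_eq_square)
  also have "\<dots> \<le> 4 / 2 ^ n * (4 * D\<^sup>2)"
  proof (rule mult_right_mono)
    \<comment> \<open>The fourth root to the power 20 n is c^(5 n). Since (3/4)^5 = 243/1024 < 1/4,
      this decay outweighs the number of terms, of order 2^n, and leaves 2^(-n).\<close>
    have "sqrt (sqrt c) ^ (20 * n) = c ^ (5 * n)" if "0 \<le> c" for c :: real
    proof -
      have "sqrt (sqrt c) ^ (20 * n) = (((sqrt (sqrt c))\<^sup>2)\<^sup>2) ^ (5 * n)"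
        by (simp only: power_mult[symmetric]) simp
      then show ?thesis using that by simp
    qed
    from this[of "3/4"] have "sqrt (sqrt (3/4)) ^ (20 * n) = (3/4) ^ (5 * n)"
      by (simp only: divide_nonneg_nonneg zero_le_numeral)
    also have "\<dots> = ((3/4) ^ 5) ^ n" by (rule power_mult)
    also have "\<dots> \<le> (1/4) ^ n" by (intro power_mono) (simp_all add: power_divide)
    finally have decay: "sqrt (sqrt (3/4)) ^ (20 * n) \<le> (1/4) ^ n" .
    have "(1::real) \<le> 2 ^ n" by simp
    moreover have "real ?N = 1 + 2 * 2 ^ n" by simp
    ultimately have "real ?N \<le> 4 * 2 ^ n" by linarith
    with decay have "real ?N * sqrt (sqrt (3/4)) ^ (20 * n) \<le> 4 * 2 ^ n * (1/4) ^ n"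
      by (intro mult_mono) simp_all
    also have "\<dots> = 4 / 2 ^ n"
    proof -
      have "(4::real) ^ n = 2 ^ n * 2 ^ n" by (simp flip: power_mult_distrib)
      then show ?thesis by (simp add: power_divide)
    qed
    finally show "real ?N * sqrt (sqrt (3/4)) ^ (20 * n) \<le> 4 / 2 ^ n" .
  qed simp
  also have "\<dots> = 16 * D\<^sup>2 / T * (T / 2 ^ n)" using T by simp
  also have "\<dots> \<le> 16 * D\<^sup>2 / T * level_error T n"
    using level_error_ge'[of T n] T by (intro mult_left_mono) auto
  finally have pert: "\<bar>grid_energy ?N x l a t - grid_energy ?N x (real (?f l) * \<eta>) (real (?f a) * \<eta>) (real (?f t) * \<eta>)\<bar>
      \<le> 16 * D\<^sup>2 / T * level_error T n" .
  have "\<eta> \<le> T / 2 ^ n" unfolding \<eta> using T by (intro divide_left_mono power_increasing) auto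
  then have "\<bar>t - real (?f t) * \<eta>\<bar> \<le> level_error T n"
    using close[of t] t level_error_ge'[of T n] T by simp
  with pert main show ?thesis by (simp add: ring_distribs)
qed

lemma dyadic_scale_exists:
  fixes T :: real
  assumes "0 < l" "l \<le> T"
  obtains n where "T / 2 ^ Suc n < l" "l \<le> T / 2 ^ n"
proof -
  have "0 < l / T" using assms by simp
  then obtain k where "(1/2) ^ k < l / T" using real_arch_pow_inv[of "l / T" "1/2"] by auto
  then have k: "T / 2 ^ k < l" using assms by (simp add: field_simps power_divide)
  define k0 where "k0 = (LEAST k. T / 2 ^ k < l)"
  have k0: "T / 2 ^ k0 < l" unfolding k0_def using k by (rule LeastI)
  then have "k0 \<noteq> 0" using assms by (intro notI) simp
  then obtain n where n: "k0 = Suc n" by (auto simp: gr0_conv_Suc)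
  have "\<not> T / 2 ^ n < l" using not_less_Least[of n "\<lambda>k. T / 2 ^ k < l"] n by (simp add: k0_def)
  then show thesis using that[of n] k0 n by simp
qed

text \<open>\<open>r * (1 - ln r)\<close> is r log (e / r), the squared error scale at relative mesh
  r. Its monotonicity follows from ln y \<le> y - 1 at y = s / r, together with ln s \<le>
  0.\<close>

lemma mult_one_minus_ln_mono:
  fixes r s :: real
  assumes "0 < r" "r \<le> s" "s \<le> 1"
  shows "r * (1 - ln r) \<le> s * (1 - ln s)"
proof -
  have "ln (s / r) \<le> s / r - 1" using assms by (intro ln_le_minus_one) auto
  then have "r * ln (s / r) \<le> r * (s / r - 1)" using assms by (intro mult_left_mono) auto
  then have "r * (ln s - ln r) \<le> s - r" using assms by (simp add: ln_div algebra_simps)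
  moreover have "0 \<le> (s - r) * (- ln s)" using assms by (intro mult_nonneg_nonneg) auto
  ultimately show ?thesis by (simp add: algebra_simps)
qed

text \<open>At r = 2^(-(n + 1)) the function r log (e / r) is at least (n + 1) r / 2, because ln 2
  \<ge> 1/2; monotonicity carries this up to \<delta> / T. Thus one \<delta> dominates the errors of
  all finer levels.\<close>

lemma level_error_le_sqrt_log:
  assumes T: "0 < T" and \<delta>: "T / 2 ^ Suc n \<le> \<delta>" "\<delta> \<le> T"
  shows "level_error T n \<le> 2 * sqrt (T * \<delta> * ln (exp 1 * T / \<delta>))"
proof -
  define r s where "r = 1 / (2::real) ^ Suc n" and "s = \<delta> / T"
  have "0 < T / 2 ^ Suc n" using T by simp
  then have \<delta>0: "0 < \<delta>" using \<delta> by linarith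
  have r: "0 < r" by (simp add: r_def)
  have rs: "r \<le> s" "s \<le> 1" using \<delta> T by (simp_all add: r_def s_def field_simps)
  have "ln r = - (real (Suc n) * ln 2)" unfolding r_def by (simp only: ln_div ln_realpow) (simp add: ln_div ln_realpow)
  moreover have "real (Suc n) * (1/2) \<le> real (Suc n) * ln 2"
    using ln2_ge_two_thirds by (intro mult_left_mono) auto
  ultimately have "real (Suc n) / 2 \<le> 1 - ln r" by linarith
  then have "real (Suc n) / 2 * r \<le> (1 - ln r) * r" using r by (intro mult_right_mono) auto
  then have "real (Suc n) / 2 * r \<le> s * (1 - ln s)"
    using mult_one_minus_ln_mono[OF r rs] by (simp add: mult.commute)
  then have "T\<^sup>2 * (4 * (real (Suc n) / 2 * r)) \<le> T\<^sup>2 * (4 * (s * (1 - ln s)))"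
    by (intro mult_left_mono) auto
  moreover have "4 * (real (Suc n) / 2 * r) = real (Suc n) / 2 ^ n"
    by (simp add: r_def del: of_nat_Suc)
  then have "T\<^sup>2 * (4 * (real (Suc n) / 2 * r)) = (level_error T n)\<^sup>2"
    by (simp add: level_error_def power_mult_distrib)
  moreover have "T\<^sup>2 * (4 * (s * (1 - ln s))) = 4 * (T * \<delta> * ln (exp 1 * T / \<delta>))"
    using T \<delta>0 by (simp add: s_def ln_div ln_mult power2_eq_square)
  ultimately have "(level_error T n)\<^sup>2 \<le> 4 * (T * \<delta> * ln (exp 1 * T / \<delta>))" by (simp only:)
  then have "level_error T n \<le> sqrt (4 * (T * \<delta> * ln (exp 1 * T / \<delta>)))" by (rule real_le_rsqrt)
  then show ?thesis by (simp only: real_sqrt_mult real_sqrt_four)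
qed

text \<open>On the event where both the modulus and the net estimate hold, the argument is
  deterministic, and the constant depends on the path only through \<open>D\<close>. Each mesh is
  treated at its own dyadic level.\<close>

lemma (in standard_brownian_motion) AE_Omega2_bound:
  assumes T: "0 < T"
  shows "AE \<omega> in M. \<exists>C::real. \<forall>\<^sub>F \<delta> in at_right 0.
    Omega2 T (\<lambda>t. W t \<omega>) \<delta> \<le> ennreal (C * sqrt (T * \<delta> * ln (exp 1 * T / \<delta>)))"
  using AE_geometric_modulus[OF T] AE_grid_energy_net[OF T]
proof eventually_elim
  case (elim \<omega>)
  let ?x = "\<lambda>t. W t \<omega>"
  from elim(1) obtain D where modulus: "\<And>m s t. s \<in> {0..T} \<Longrightarrow> t \<in> {0..T} \<Longrightarrow> \<bar>s - t\<bar> \<le> T / 2 ^ m \<Longrightarrow>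
      \<bar>?x s - ?x t\<bar> \<le> D * sqrt (sqrt (3/4)) ^ m" by blast
  from elim(2) obtain n0 where net: "\<And>n i j k. n \<ge> n0 \<Longrightarrow>
      i \<le> 2 ^ (21 * n + 3) \<Longrightarrow> j \<le> 2 ^ (21 * n + 3) \<Longrightarrow> k \<le> 2 ^ (21 * n + 3) \<Longrightarrow>
      T / 2 ^ Suc n \<le> real i * (T / 2 ^ (21 * n + 3)) \<Longrightarrow> real i * (T / 2 ^ (21 * n + 3)) \<le> T / 2 ^ n \<Longrightarrow> j \<le> i \<Longrightarrow>
      \<bar>grid_energy (Suc (2 ^ Suc n)) ?x (real i * (T / 2 ^ (21 * n + 3))) (real j * (T / 2 ^ (21 * n + 3)))
        (real k * (T / 2 ^ (21 * n + 3))) - real k * (T / 2 ^ (21 * n + 3))\<bar> < 264 * level_error T n"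
    unfolding eventually_sequentially by blast
  define C where "C = 16 * D\<^sup>2 / T + 265"
  have C: "0 \<le> C" using T by (simp add: C_def)
  have "Omega2 T ?x \<delta> \<le> ennreal (2 * C * sqrt (T * \<delta> * ln (exp 1 * T / \<delta>)))"
    if \<delta>: "0 < \<delta>" "\<delta> < T / 2 ^ n0" for \<delta>
    unfolding Omega2_def grid_deviation_def
  proof (intro SUP_least ennreal_leI)
    fix l a t assume l: "l \<in> {l. 0 < l \<and> l \<le> \<delta> \<and> l \<le> T}" and a: "a \<in> {0..<l}" and t: "t \<in> {0..T}"
    obtain n where n: "T / 2 ^ Suc n < l" "l \<le> T / 2 ^ n" using dyadic_scale_exists[of l T] l by auto
    \<comment> \<open>A mesh l \<le> \<delta> < T / 2^n0 belongs to a level n \<ge> n0, where the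
      net estimate is valid.\<close>
    have "T / 2 ^ Suc n < T / 2 ^ n0" using n l \<delta> by simp
    then have "(2::real) ^ n0 < 2 ^ Suc n" using T by (simp add: divide_simps)
    then have "n0 < Suc n" by (rule power_less_imp_less_exp[rotated]) simp
    then have n0: "n \<ge> n0" by simp
    have "2 ^ Suc n * (T / 2 ^ Suc n) \<le> 2 ^ Suc n * l" using n by (intro mult_left_mono) auto
    then have "stopped_energy (shifted_grid T l a) ?x t = grid_energy (Suc (2 ^ Suc n)) ?x l a t"
      using l a t by (intro stopped_energy_shifted_grid) auto
    moreover have "\<bar>grid_energy (Suc (2 ^ Suc n)) ?x l a t - t\<bar> \<le> C * level_error T n"
      unfolding C_def
      by (rule grid_energy_level_bound[OF T net[OF n0] refl modulus]) (use n a t in auto)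
    \<comment> \<open>This yields \<delta> \<le> T; with T / 2^(n + 1) < l \<le> \<delta>, the error
      at level n is bounded by the scale at \<delta>.\<close>
    moreover have "T / 2 ^ n0 \<le> T / 1" using T by (intro divide_left_mono) auto
    then have "C * level_error T n \<le> C * (2 * sqrt (T * \<delta> * ln (exp 1 * T / \<delta>)))"
      using l n \<delta> C T by (intro mult_left_mono level_error_le_sqrt_log) auto
    ultimately show "\<bar>stopped_energy (shifted_grid T l a) ?x t - t\<bar> \<le> 2 * C * sqrt (T * \<delta> * ln (exp 1 * T / \<delta>))"
      by simp
  qed
  moreover have "0 < T / 2 ^ n0" using T by simp
  ultimately show ?case unfolding eventually_at_right[OF zero_less_one] by blast
qed

section \<open>Rough paths and the dyadic roughness modulus\<close>

lemma stopped_energy_le_Omega2: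
  assumes "0 < l" "l \<le> \<delta>" "l \<le> T" "0 \<le> a" "a < l" "t \<in> {0..T}"
  shows "ennreal \<bar>stopped_energy (shifted_grid T l a) x t - t\<bar> \<le> Omega2 T x \<delta>"
  unfolding Omega2_def grid_deviation_def
  by (rule SUP_upper2[of l], use assms in simp, rule SUP_upper2[of a], use assms in simp,
      rule SUP_upper2[of t]) (use assms in simp_all)

text \<open>Indices congruent to r modulo b are the numbers r + k b, so the step b becomes the mesh
  and the residue r the offset, both in units of \<open>T / 2 ^ m\<close>.\<close>

lemma dyadic_subgrid_eq_shifted_grid:
  assumes T: "0 < T" and r: "r < b"
  shows "dyadic_subgrid T m b r = shifted_grid T (real b * (T / 2 ^ m)) (real r * (T / 2 ^ m))"
proof -
  let ?h = "T / 2 ^ m"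
  have h: "0 < ?h" "2 ^ m * ?h = T" using T by simp_all
  have lt: "0 < real_of_int z * ?h \<longleftrightarrow> 0 < z" "real_of_int z * ?h < T \<longleftrightarrow> z < 2 ^ m" for z
  proof -
    have "0 < real_of_int z * c \<longleftrightarrow> 0 < z" if "0 < c" for c
      using that by (simp add: zero_less_mult_iff)
    then show "0 < real_of_int z * ?h \<longleftrightarrow> 0 < z" using h(1) .
    have "real_of_int z * ?h < 2 ^ m * ?h \<longleftrightarrow> real_of_int z < 2 ^ m"
      using h(1) by (rule mult_less_cancel_right_pos)
    also have "\<dots> \<longleftrightarrow> real_of_int z < real_of_int (2 ^ m)" by simp
    finally show "real_of_int z * ?h < T \<longleftrightarrow> z < 2 ^ m" unfolding h(2) of_int_less_iff .
  qed
  have lin: "real r * ?h + of_int k * (real b * ?h) = of_int (int r + k * int b) * ?h" for k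
    by (simp add: ring_distribs mult_ac)
  have "{real j * ?h | j. 1 \<le> j \<and> j < 2 ^ m \<and> j mod b = r mod b}
      = {of_int (int r + k * int b) * ?h | k. 0 < int r + k * int b \<and> int r + k * int b < 2 ^ m}"
  proof (intro equalityI subsetI)
    fix s assume "s \<in> {real j * ?h | j. 1 \<le> j \<and> j < 2 ^ m \<and> j mod b = r mod b}"
    then obtain j where j: "s = real j * ?h" "1 \<le> j" "j < 2 ^ m" "j mod b = r" using r by auto
    have eq: "int r + int (j div b) * int b = int j"
      using j(4) by (metis mod_mult_div_eq mult.commute of_nat_add of_nat_mult)
    have "int j < 2 ^ m" using j(3) by (metis of_nat_less_iff of_nat_numeral of_nat_power)
    then show "s \<in> {of_int (int r + k * int b) * ?h | k. 0 < int r + k * int b \<and> int r + k * int b < 2 ^ m}"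
      using eq j(1,2) by (intro CollectI exI[of _ "int (j div b)"]) (simp only: eq, simp)
  next
    fix s assume "s \<in> {of_int (int r + k * int b) * ?h | k. 0 < int r + k * int b \<and> int r + k * int b < 2 ^ m}"
    then obtain k where k: "s = of_int (int r + k * int b) * ?h" "0 < int r + k * int b" "int r + k * int b < 2 ^ m"
      by blast
    then obtain j where j: "int j = int r + k * int b" by (metis zero_less_imp_eq_int)
    have "int (j mod b) = int (r mod b)" by (simp add: zmod_int j)
    then have "j mod b = r mod b" by (simp only: of_nat_eq_iff)
    moreover have "1 \<le> j" using k(2) j by linarith
    moreover have "int j < int (2 ^ m)" using k(3) j by simp
    then have "j < 2 ^ m" by (simp only: of_nat_less_iff)
    moreover have "s = real j * ?h" unfolding k(1) j[symmetric] by simp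
    ultimately show "s \<in> {real j * ?h | j. 1 \<le> j \<and> j < 2 ^ m \<and> j mod b = r mod b}" by blast
  qed
  then show ?thesis unfolding dyadic_subgrid_def shifted_grid_def lin lt by simp
qed

text \<open>Step 1 makes the full dyadic grid a shifted grid as well, so \<open>Omega2\<close>
  controls both energies in the roughness modulus.\<close>

lemma dyadic_grid_eq_subgrid: "dyadic_grid T m = dyadic_subgrid T m 1 0"
proof -
  have "j \<le> 2 ^ m \<longleftrightarrow> j = 0 \<or> j = 2 ^ m \<or> (1 \<le> j \<and> j < 2 ^ m)" for j :: nat by auto
  then have "dyadic_grid T m = {real j * (T / 2 ^ m) | j. j = 0 \<or> j = 2 ^ m \<or> (1 \<le> j \<and> j < 2 ^ m)}"
    by (simp add: dyadic_grid_def)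
  also have "\<dots> = dyadic_subgrid T m 1 0"
    unfolding dyadic_subgrid_def by force
  finally show ?thesis .
qed

text \<open>Triangle inequality through \<open>t\<close>. The condition b \<le> 2^m / L gives the
  subgrid a mesh of at most T / L, and the full grid is finer still; the two comparisons give the
  factor 2.\<close>

lemma dyadic_roughness2_le_Omega2:
  assumes T: "0 < T" and L: "0 < L"
  shows "dyadic_roughness2 T L x \<le> 2 * Omega2 T x (T / real L)"
  unfolding dyadic_roughness2_def
proof (intro Limsup_bounded always_eventually allI SUP_least)
  fix m b r t
  assume b: "b \<in> {L..2 ^ m div L}" and r: "r \<in> {..<b}" and t: "t \<in> {0..T}"
  let ?h = "T / 2 ^ m"
  let ?V = "\<lambda>P. stopped_energy P x t"
  have h: "0 < ?h" using T by simp
  have "b * L \<le> 2 ^ m div L * L" using b by (intro mult_right_mono) auto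
  also have "\<dots> \<le> 2 ^ m" by simp
  finally have "real (b * L) \<le> real (2 ^ m)" by (simp only: of_nat_le_iff)
  then have bL: "real b * ?h \<le> T / real L" using T L by (simp add: field_simps)
  have b1: "1 * ?h \<le> real b * ?h" using b L h by (intro mult_right_mono) auto
  have rb: "real r * ?h < real b * ?h" using r h by (intro mult_strict_right_mono) auto
  have LT: "T / real L \<le> T / 1" using T L by (intro divide_left_mono) auto
  have "ennreal \<bar>?V (dyadic_subgrid T m b r) - t\<bar> \<le> Omega2 T x (T / real L)"
    using T r t bL b1 LT h rb unfolding dyadic_subgrid_eq_shifted_grid[OF T, of r b, simplified, OF r[simplified]]
    by (intro stopped_energy_le_Omega2) auto
  moreover have "ennreal \<bar>?V (dyadic_grid T m) - t\<bar> \<le> Omega2 T x (T / real L)"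
    using T t bL b1 LT h unfolding dyadic_grid_eq_subgrid dyadic_subgrid_eq_shifted_grid[OF T zero_less_one]
    by (intro stopped_energy_le_Omega2) auto
  ultimately have "ennreal (\<bar>?V (dyadic_subgrid T m b r) - t\<bar> + \<bar>?V (dyadic_grid T m) - t\<bar>)
      \<le> 2 * Omega2 T x (T / real L)"
    unfolding mult_2 by (subst ennreal_plus) (auto intro: add_mono)
  moreover have "ennreal \<bar>?V (dyadic_subgrid T m b r) - ?V (dyadic_grid T m)\<bar>
      \<le> ennreal (\<bar>?V (dyadic_subgrid T m b r) - t\<bar> + \<bar>?V (dyadic_grid T m) - t\<bar>)"
    by (intro ennreal_leI) linarith
  ultimately show "ennreal \<bar>?V (dyadic_subgrid T m b r) - ?V (dyadic_grid T m)\<bar> \<le> 2 * Omega2 T x (T / real L)"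
    by (rule order_trans[rotated])
qed

text \<open>The identity serves as the function A, and \<delta> log (e T / \<delta>) tends to
  0.\<close>

lemma rough_paths2_if_Omega2_bound:
  assumes T: "0 < T" and cont: "continuous_on {0..T} x"
    and bound: "\<forall>\<^sub>F \<delta> in at_right 0. Omega2 T x \<delta> \<le> ennreal (C * sqrt (T * \<delta> * ln (exp 1 * T / \<delta>)))"
  shows "x \<in> rough_paths2 T"
proof -
  have "((\<lambda>\<delta>. sqrt (T * \<delta> * ln (exp 1 * T / \<delta>))) \<longlongrightarrow> 0) (at_right 0)"
    using T by real_asymp
  then have "((\<lambda>\<delta>. C * sqrt (T * \<delta> * ln (exp 1 * T / \<delta>))) \<longlongrightarrow> 0) (at_right 0)"
    by (rule tendsto_mult_right_zero)
  then have "((\<lambda>\<delta>. ennreal (C * sqrt (T * \<delta> * ln (exp 1 * T / \<delta>)))) \<longlongrightarrow> 0) (at_right 0)"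
    using tendsto_ennrealI by force
  from tendsto_sandwich[OF _ bound tendsto_const this]
  have "(Omega2 T x \<longlongrightarrow> 0) (at_right 0)" by simp
  then have "(grid_deviation T x (\<lambda>t. t) \<longlongrightarrow> 0) (at_right 0)"
    by (simp add: Omega2_def[abs_def])
  then show ?thesis
    using T cont unfolding rough_paths2_def
    by (auto intro!: exI[of _ "\<lambda>t. t"] mono_onI)
qed

text \<open>Substituting \<delta> = T / L turns e T / \<delta> into e L and takes T out of the
  root.\<close>

lemma dyadic_roughness2_bound:
  assumes T: "0 < T"
    and bound: "\<forall>\<^sub>F \<delta> in at_right 0. Omega2 T x \<delta> \<le> ennreal (C * sqrt (T * \<delta> * ln (exp 1 * T / \<delta>)))"
  shows "\<forall>\<^sub>F L in sequentially. dyadic_roughness2 T L x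
    \<le> ennreal (2 * C * (T * sqrt (ln (exp 1 * real L) / real L)))"
proof -
  have "filterlim (\<lambda>L. T / real L) (at_right 0) sequentially"
    using T by real_asymp
  from eventually_compose_filterlim[OF bound this] eventually_gt_at_top[of 0]
  show ?thesis
  proof eventually_elim
    case (elim L)
    have "T * (T / real L) * ln (exp 1 * T / (T / real L)) = T\<^sup>2 * (ln (exp 1 * real L) / real L)"
      using T by (simp add: power2_eq_square)
    then have "sqrt (T * (T / real L) * ln (exp 1 * T / (T / real L))) = T * sqrt (ln (exp 1 * real L) / real L)"
      by (simp only: real_sqrt_mult real_sqrt_abs abs_of_pos[OF T])
    with elim(1) have "2 * Omega2 T x (T / real L) \<le> 2 * ennreal (C * (T * sqrt (ln (exp 1 * real L) / real L)))"
      by (intro mult_left_mono) auto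
    also have "\<dots> = ennreal (2 * C * (T * sqrt (ln (exp 1 * real L) / real L)))"
      using ennreal_mult'[of 2 "C * (T * sqrt (ln (exp 1 * real L) / real L))"] by (simp add: mult.assoc)
    finally show ?case using dyadic_roughness2_le_Omega2[OF T elim(2), of x] by (rule order_trans[rotated])
  qed
qed

theorem theorem6p2:
  fixes M :: "'a measure" and T :: real and W :: "real \<Rightarrow> 'a \<Rightarrow> real"
  assumes "0 < T"
    and "standard_brownian_motion M T W"
  shows "(\<exists>E\<in>sets M. measure M E = 1 \<and>
           (\<forall>\<omega>\<in>E. \<exists>C::real. \<forall>\<^sub>F \<delta> in at_right 0.
              Omega2 T (\<lambda>t. W t \<omega>) \<delta> \<le> ennreal (C * sqrt (T * \<delta> * ln (exp 1 * T / \<delta>)))))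
    \<and> (AE \<omega> in M. (\<lambda>t. W t \<omega>) \<in> rough_paths2 T)
    \<and> (AE \<omega> in M. \<exists>C::real. \<forall>\<^sub>F L in sequentially.
           dyadic_roughness2 T L (\<lambda>t. W t \<omega>)
             \<le> ennreal (C * (T * sqrt (ln (exp 1 * real L) / real L))))"
proof -
  interpret standard_brownian_motion M T W by fact
  note bound = AE_Omega2_bound[OF assms(1)]
  \<comment> \<open>The set of good paths need not be measurable, so the required event is the
    complement of a measurable null set covering the bad ones.\<close>
  obtain N where N: "{\<omega>\<in>space M. \<not> (\<exists>C::real. \<forall>\<^sub>F \<delta> in at_right 0.
      Omega2 T (\<lambda>t. W t \<omega>) \<delta> \<le> ennreal (C * sqrt (T * \<delta> * ln (exp 1 * T / \<delta>))))} \<subseteq> N"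
    "emeasure M N = 0" "N \<in> sets M"
    using bound by (rule AE_E)
  have "space M - N \<in> sets M" using N(3) by auto
  moreover have "measure M (space M - N) = 1"
    using N(2) prob_compl[OF N(3)] by (simp add: measure_def)
  moreover have "\<forall>\<omega>\<in>space M - N. \<exists>C::real. \<forall>\<^sub>F \<delta> in at_right 0.
      Omega2 T (\<lambda>t. W t \<omega>) \<delta> \<le> ennreal (C * sqrt (T * \<delta> * ln (exp 1 * T / \<delta>)))"
    using N(1) by blast
  moreover have "AE \<omega> in M. (\<lambda>t. W t \<omega>) \<in> rough_paths2 T"
    using bound continuous_paths
    by eventually_elim (use assms(1) rough_paths2_if_Omega2_bound in blast)
  moreover have "AE \<omega> in M. \<exists>C::real. \<forall>\<^sub>F L in sequentially.
      dyadic_roughness2 T L (\<lambda>t. W t \<omega>) \<le> ennreal (C * (T * sqrt (ln (exp 1 * real L) / real L)))"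
    using bound by eventually_elim (use assms(1) dyadic_roughness2_bound in blast)
  ultimately show ?thesis by blast
qed

end
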